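(* Let $K\subset\mathbb{R}^2$ be a convex body with $o\in\operatorname{int}K$, let $T$ be a triangle, and suppose $$|K|\cdot|K^*|\le(1+\varepsilon)\cdot 27/4,\quad\text{with } \varepsilon>0.$$ Then $\delta_{BM}(K,T)\le 1+900\,\varepsilon$. Moreover, let $x\in\mathbb{R}^2$ and $\lambda_1,\lambda_2>0$, and let $T$ be a triangle such that $\lambda_1T+x\subset K\subset\lambda_2T+x$ and $\lambda_2/\lambda_1\le 1+900\,\varepsilon<4$. Then, in the Euclidean norm for which $[(\lambda_1+\lambda_2)/2]T$ is a regular triangle of side $1$, the distance of the centre of $[(\lambda_1+\lambda_2)/2]T+x$ from $o$ is at most $917\cdot\sqrt{\varepsilon}$.
   Context: $o$ is the origin of $\mathbb{R}^2$, $\langle\cdot,\cdot\rangle$ the scalar product, $|\cdot|$ denotes area. A convex body is a compact convex set with non-empty interior. Triangles are understood as (closed, non-degenerate) two-dimensional convex bodies. For a convex body $K$ with $o\in\operatorname{int}K$ the polar is $K^*=\{x\in\mathbb{R}^2:\ \langle x,y\rangle\le 1\ \text{for all } y\in K\}$. For convex bodies $K,L\subset\mathbb{R}^2$ the Banach-Mazur distance is $$\delta_{BM}(K,L)=\min\{\lambda_2/\lambda_1:\ \lambda_1,\lambda_2\in(0,\infty),\ \exists\text{ affinity }A,\ \exists x\in\mathbb{R}^2,\ \lambda_1A(K)\subset L\subset\lambda_2A(K)+x\}.$$ "The Euclidean norm for which a set is a regular triangle of side $1$" means the norm on $\mathbb{R}^2$ induced by an inner product (in general different from the standard one) with respect to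 which the given triangle is regular with side length $1$; the distance in the conclusion is measured in this norm. The centre of a triangle is its centroid. *)

theory Defs
  imports "HOL-Analysis.Analysis"
begin

definition convex_body :: "(real^2) set \<Rightarrow> bool" where
  "convex_body K \<longleftrightarrow> compact K \<and> convex K \<and> interior K \<noteq> {}"

definition polar :: "(real^2) set \<Rightarrow> (real^2) set" where
  "polar K = {x. \<forall>y\<in>K. x \<bullet> y \<le> 1}"

abbreviation area :: "(real^2) set \<Rightarrow> real" where
  "area K \<equiv> measure lebesgue K"

definition triangle :: "(real^2) set \<Rightarrow> bool" where
  "triangle T \<longleftrightarrow> (\<exists>a b c. \<not> collinear {a, b, c} \<and> T = convex hull {a, b, c})"

definition vertices :: "(real^2) set \<Rightarrow> (real^2) set" where
  "vertices T = {v. v extreme_point_of T}"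

text \<open>The centroid, meaningful for triangles only.\<close>

definition triangle_centre :: "(real^2) set \<Rightarrow> real^2" where
  "triangle_centre T = (1/3) *\<^sub>R (\<Sum>v\<in>vertices T. v)"

definition affinity :: "(real^2 \<Rightarrow> real^2) \<Rightarrow> bool" where
  "affinity A \<longleftrightarrow> (\<exists>f b. linear f \<and> bij f \<and> A = (\<lambda>v. f v + b))"

definition homothet :: "real \<Rightarrow> (real^2) set \<Rightarrow> real^2 \<Rightarrow> (real^2) set" where
  "homothet l S x = (\<lambda>v. l *\<^sub>R v + x) ` S"

text \<open>On the reals, \<open>LEAST\<close> denotes the minimum whenever it exists and is unspecified
  otherwise; for convex bodies the minimum exists by compactness.\<close>

definition banach_mazur_distance :: "(real^2) set \<Rightarrow> (real^2) set \<Rightarrow> real" where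
  "banach_mazur_distance K L =
     (LEAST d. \<exists>l1 l2 A x. d = l2 / l1 \<and> 0 < l1 \<and> 0 < l2 \<and> affinity A \<and>
        homothet l1 (A ` K) 0 \<subseteq> L \<and> L \<subseteq> homothet l2 (A ` K) x)"

definition inner_product :: "(real^2 \<Rightarrow> real^2 \<Rightarrow> real) \<Rightarrow> bool" where
  "inner_product B \<longleftrightarrow> bilinear B \<and> (\<forall>u v. B u v = B v u) \<and> (\<forall>v. v \<noteq> 0 \<longrightarrow> 0 < B v v)"

definition euclidean_norm :: "(real^2 \<Rightarrow> real) \<Rightarrow> bool" where
  "euclidean_norm N \<longleftrightarrow> (\<exists>B. inner_product B \<and> N = (\<lambda>v. sqrt (B v v)))"

definition regular_triangle_wrt :: "(real^2 \<Rightarrow> real) \<Rightarrow> real \<Rightarrow> (real^2) set \<Rightarrow> bool" where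
  "regular_triangle_wrt N s T \<longleftrightarrow>
     triangle T \<and> (\<forall>p\<in>vertices T. \<forall>q\<in>vertices T. p \<noteq> q \<longrightarrow> N (p - q) = s)"

text \<open>The description is well-defined for every triangle \<open>T\<close>,
  see \<open>ex1_regularizing_norm\<close> below.\<close>

definition regularizing_norm :: "(real^2) set \<Rightarrow> real^2 \<Rightarrow> real" where
  "regularizing_norm T = (THE N. euclidean_norm N \<and> regular_triangle_wrt N 1 T)"

lemma noncollinear_independent:
  fixes a b c :: "real^2"
  assumes "\<not> collinear {a, b, c}"
  shows "independent {b - a, c - a}" "b - a \<noteq> c - a"
proof -
  have d: "a \<noteq> b" "a \<noteq> c" "b \<noteq> c"
    using assms by (auto simp: insert_commute)
  have "\<not> affine_dependent {a, b, c}"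
    using assms d affine_dependent_imp_collinear_3 collinear_3_eq_affine_dependent by blast
  hence "\<not> affine_dependent (insert a {b, c})"
    by simp
  moreover have "a \<notin> {b, c}" using d by auto
  ultimately have "independent ((\<lambda>x. - a + x) ` {b, c})"
    by (simp add: affine_dependent_iff_dependent)
  thus "independent {b - a, c - a}" by simp
  show "b - a \<noteq> c - a" using d by simp
qed

lemma vertices_triangle:
  fixes a b c :: "real^2"
  assumes "\<not> collinear {a, b, c}"
  shows "vertices (convex hull {a, b, c}) = {a, b, c}"
proof -
  have "\<not> affine_dependent {a, b, c}"
    using assms collinear_3_eq_affine_dependent by (auto simp: insert_commute)
  thus ?thesis
    unfolding vertices_def using extreme_point_of_convex_hull_affine_independent by blast
qed

lemma triangle_centre_convex_hull:
  fixes a b c :: "real^2"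
  assumes "\<not> collinear {a, b, c}"
  shows "triangle_centre (convex hull {a, b, c}) = (1/3) *\<^sub>R (a + b + c)"
proof -
  have "a \<noteq> b" "a \<noteq> c" "b \<noteq> c"
    using assms by (auto simp: insert_commute)
  thus ?thesis
    unfolding triangle_centre_def vertices_triangle[OF assms] by (simp add: add.assoc)
qed

lemma ex1_regularizing_norm:
  assumes "triangle T"
  shows "\<exists>!N. euclidean_norm N \<and> regular_triangle_wrt N 1 T"
proof -
  obtain a b c where nc: "\<not> collinear {a, b, c}" and T: "T = convex hull {a, b, c}"
    using assms unfolding triangle_def by blast
  define u v where "u = b - a" and "v = c - a"
  have ind: "independent {u, v}" and uv: "u \<noteq> v"
    using noncollinear_independent[OF nc] unfolding u_def v_def by auto
  have d: "a \<noteq> b" "a \<noteq> c" "b \<noteq> c"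
    using nc by (auto simp: insert_commute)
  have "UNIV \<subseteq> span {u, v}"
    using card_ge_dim_independent[of "{u, v}" UNIV] ind uv by (simp add: dim_UNIV)
  hence rep: "\<exists>s t. w = s *\<^sub>R u + t *\<^sub>R v" for w
  proof -
    have "w \<in> span {u, v}" using \<open>UNIV \<subseteq> span {u, v}\<close> by blast
    then obtain s where "w - s *\<^sub>R u \<in> span {v}"
      by (meson span_breakdown_eq)
    then obtain t where "w - s *\<^sub>R u - t *\<^sub>R v \<in> span {}"
      by (meson span_breakdown_eq)
    hence "w = s *\<^sub>R u + t *\<^sub>R v"
      by (simp add: algebra_simps)
    thus ?thesis by blast
  qed
  have reg: "regular_triangle_wrt N 1 T \<longleftrightarrow> N u = 1 \<and> N v = 1 \<and> N (u - v) = 1"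
    if N0: "euclidean_norm N" for N
  proof -
    obtain B where B: "bilinear B" and N: "N = (\<lambda>v. sqrt (B v v))"
      using N0 unfolding euclidean_norm_def inner_product_def by blast
    have "N (- w) = N w" for w
      unfolding N by (simp add: bilinear_lneg[OF B] bilinear_rneg[OF B])
    hence "N (p - q) = N (q - p)" for p q
      using minus_diff_eq[of q p] by metis
    moreover have "u - v = b - c" unfolding u_def v_def by simp
    ultimately show ?thesis
      using d assms vertices_triangle[OF nc]
      unfolding regular_triangle_wrt_def T u_def v_def by auto
  qed
  have form: "N (s *\<^sub>R u + t *\<^sub>R v) = sqrt (s\<^sup>2 + s * t + t\<^sup>2)"
    if N0: "euclidean_norm N" and NT: "regular_triangle_wrt N 1 T" for N s t
  proof -
    obtain B where bl: "bilinear B" and sym: "\<And>u v. B u v = B v u"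
      and N: "N = (\<lambda>v. sqrt (B v v))"
      using N0 unfolding euclidean_norm_def inner_product_def by blast
    note s = bilinear_ladd[OF bl] bilinear_radd[OF bl] bilinear_lsub[OF bl] bilinear_rsub[OF bl]
      bilinear_lmul[OF bl] bilinear_rmul[OF bl]
    have 1: "B u u = 1" "B v v = 1" "B (u - v) (u - v) = 1"
      using NT reg[OF N0] N by auto
    have "B (u - v) (u - v) = B u u - 2 * B u v + B v v"
      using sym[of v u] by (simp add: s)
    hence 2: "B u v = 1/2" using 1 by simp
    have "B (s *\<^sub>R u + t *\<^sub>R v) (s *\<^sub>R u + t *\<^sub>R v) = s\<^sup>2 * B u u + 2 * s * t * B u v + t\<^sup>2 * B v v"
      using sym[of v u] by (simp add: s algebra_simps power2_eq_square)
    also have "\<dots> = s\<^sup>2 + s * t + t\<^sup>2" using 1 2 by simp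
    finally show ?thesis unfolding N by simp
  qed
  obtain f :: "real^2 \<Rightarrow> real^2" where f: "linear f"
    and fu: "f u = vector [1, 0]" and fv: "f v = vector [1/2, sqrt 3 / 2]"
    using linear_independent_extend[OF ind,
        of "\<lambda>w. if w = u then vector [1, 0] else vector [1/2, sqrt 3 / 2]"] uv by auto
  define B where "B x y = f x \<bullet> f y" for x y
  have B_rep: "B (s *\<^sub>R u + t *\<^sub>R v) (s *\<^sub>R u + t *\<^sub>R v) = s\<^sup>2 + s * t + t\<^sup>2" for s t
    unfolding B_def
    by (simp add: linear_add[OF f] linear_scale[OF f] fu fv inner_vec_def sum_2
        algebra_simps power2_eq_square)
  have pos: "0 < B w w" if "w \<noteq> 0" for w
  proof -
    obtain s t where w: "w = s *\<^sub>R u + t *\<^sub>R v" using rep by blast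
    have "s \<noteq> 0 \<or> t \<noteq> 0" using that w by auto
    moreover have "s\<^sup>2 + s * t + t\<^sup>2 = (s + t/2)\<^sup>2 + 3/4 * t\<^sup>2"
      by (simp add: power2_eq_square algebra_simps)
    ultimately have "0 < s\<^sup>2 + s * t + t\<^sup>2"
      by (cases "t = 0") (auto intro: add_nonneg_pos)
    thus ?thesis using B_rep w by simp
  qed
  have "bilinear B"
    unfolding bilinear_def B_def
    by (auto intro!: linearI simp: linear_add[OF f] linear_scale[OF f] inner_add_left inner_add_right)
  hence E: "euclidean_norm (\<lambda>w. sqrt (B w w))"
    unfolding euclidean_norm_def inner_product_def
    using pos by (intro exI[of _ B]) (auto simp: B_def inner_commute)
  have R: "regular_triangle_wrt (\<lambda>w. sqrt (B w w)) 1 T"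
    using reg[OF E] B_rep[of 1 0] B_rep[of 0 1] B_rep[of 1 "-1"] by simp
  show ?thesis
  proof (rule ex1I)
    show "euclidean_norm (\<lambda>w. sqrt (B w w)) \<and> regular_triangle_wrt (\<lambda>w. sqrt (B w w)) 1 T"
      using E R by blast
    fix N assume N: "euclidean_norm N \<and> regular_triangle_wrt N 1 T"
    show "N = (\<lambda>w. sqrt (B w w))"
    proof
      fix w
      obtain s t where "w = s *\<^sub>R u + t *\<^sub>R v" using rep by blast
      thus "N w = sqrt (B w w)" using form N B_rep by simp
    qed
  qed
qed

end

theory Submission
  imports Defs
begin

text \<open>
  Write \<open>wedge u v\<close> for the determinant of two vectors, and consider a sector of \<open>K\<close> between
  boundary points \<open>a\<close> and \<open>a'\<close>, together with the sector of the polar body between normals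
  \<open>b\<close> and \<open>b'\<close> of supporting lines at these points. Testing convexity of both bodies with
  quadrilaterals shows that the areas \<open>p\<close> and \<open>q\<close> of the two sectors satisfy
  \<open>2 - a \<bullet> b' - a' \<bullet> b \<le> 4 * p * q\<close> (lemma \<open>sector_product_ge\<close>).

  Now let the triangle \<open>a, b, c\<close> with vertices in \<open>K\<close> contain the origin and maximise the product
  of the three areas that its sides span with the origin. The first-order condition at each vertex
  yields an explicit supporting line of \<open>K\<close>, and for these normals the left-hand side above is
  \<open>2 + (\<rho> + 1/\<rho>) / 2 \<ge> 3\<close> in each of the three sectors, \<open>\<rho>\<close> being a ratio of two
  of the areas. By the inequality of arithmetic and geometric means the volume product is at least
  \<open>9 * (3/4) = 27/4\<close>.

  For stability, let \<open>x\<close> be the height of a sector, measured from the origin perpendicularly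
  to its chord in units of the distance of the chord, so that \<open>x = 1\<close> means that the sector is a
  triangle. Dividing the sector at its farthest point, and the polar
  sector at the corresponding normal, and applying the product inequality to both halves gains a
  factor that exceeds 1 except near the two extremes \<open>x = 1\<close> and \<open>x = 4\<close> (lemma
  \<open>sector_farthest_point\<close>). If \<open>\<epsilon> < 1/300\<close>, every \<open>x\<close> is therefore at most
  1.05 or at least 3.1. Sectors of different kinds would violate the equality case of the
  Cauchy-Schwarz inequality, and if all three sectors were far from triangles, their farthest points
  would form a triangle contradicting maximality. Hence all \<open>x\<close> are close to 1; there the gain is linear in
  \<open>x - 1\<close>, so that the sum of the \<open>x - 1\<close> is at most \<open>16 * \<epsilon>\<close> (lemma
  \<open>balanced_triangle_stability\<close>). As \<open>K\<close> lies in the triangle bounded by the lines at these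
  heights, which is homothetic to the inscribed one, the Banach-Mazur distance is bounded. For
  \<open>\<epsilon> \<ge> 1/300\<close> the bound 4 coming from an inscribed triangle of maximal area suffices.

  The position of the origin follows from a direct comparison. If \<open>K\<close> lies between two homothetic
  triangles of ratio close to 1, its volume product is nearly bounded below by that of the outer
  triangle, which is \<open>1 / (4 * \<mu>1 * \<mu>2 * \<mu>3)\<close> in terms of the barycentric coordinates
  of the origin. So \<open>27 * \<mu>1 * \<mu>2 * \<mu>3\<close> is close to its maximum 1, and the deviation of the
  coordinates from \<open>1/3\<close> is of order \<open>sqrt \<epsilon>\<close> (lemma \<open>centre_near_origin\<close>).
\<close>

section \<open>The area form and sectors of convex bodies\<close>

definition wedge :: "real^2 \<Rightarrow> real^2 \<Rightarrow> real" where
  "wedge u v = u$1 * v$2 - u$2 * v$1"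

text \<open>The quarter turn that represents the functionals \<open>\<lambda>y. wedge y w\<close> by vectors, so that they can
  be elements of a polar body.\<close>

definition turn :: "real^2 \<Rightarrow> real^2" where
  "turn w = vector [w$2, - w$1]"

lemma inner_2: "(u::real^2) \<bullet> v = u$1 * v$1 + u$2 * v$2"
  by (simp add: inner_vec_def sum_2)

lemma inner_turn: "y \<bullet> turn w = wedge y w"
  by (simp add: inner_2 turn_def wedge_def)

lemma turn_inner: "turn w \<bullet> y = wedge y w"
  using inner_turn by (metis inner_commute)

lemma wedge_turn: "wedge (turn u) v = u \<bullet> v"
  by (simp add: inner_2 turn_def wedge_def)

lemma wedge_self [simp]: "wedge u u = 0"
  by (simp add: wedge_def)

lemma wedge_zero [simp]: "wedge 0 u = 0" "wedge u 0 = 0"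
  by (simp_all add: wedge_def)

lemma wedge_swap: "wedge v u = - wedge u v"
  by (simp add: wedge_def)

lemma wedge_algebra:
  "wedge (u + v) w = wedge u w + wedge v w" "wedge w (u + v) = wedge w u + wedge w v"
  "wedge (u - v) w = wedge u w - wedge v w" "wedge w (u - v) = wedge w u - wedge w v"
  "wedge (c *\<^sub>R u) w = c * wedge u w" "wedge w (c *\<^sub>R u) = c * wedge w u"
  by (simp_all add: wedge_def algebra_simps)

lemma wedge_inner_expand:
  "wedge a a' * wedge b b' = (a \<bullet> b) * (a' \<bullet> b') - (a \<bullet> b') * (a' \<bullet> b)"
  by (simp add: wedge_def inner_2 algebra_simps)

lemma wedge_coordinates:
  assumes "wedge a a' \<noteq> 0"
  shows "x = (wedge x a' / wedge a a') *\<^sub>R a + (wedge a x / wedge a a') *\<^sub>R a'"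
proof -
  have "wedge a a' *\<^sub>R x = wedge x a' *\<^sub>R a + wedge a x *\<^sub>R a'"
    by (simp add: wedge_def vec_eq_iff forall_2 algebra_simps)
  hence "(1 / wedge a a') *\<^sub>R (wedge a a' *\<^sub>R x)
      = (1 / wedge a a') *\<^sub>R (wedge x a' *\<^sub>R a + wedge a x *\<^sub>R a')"
    by simp
  thus ?thesis using assms by (simp add: scaleR_add_right)
qed

lemma wedge_three_term:
  "wedge u v * wedge x w = wedge u x * wedge v w + wedge u w * wedge x v"
  by (simp add: wedge_def algebra_simps)

lemma continuous_on_wedge [continuous_intros]:
  assumes "continuous_on S f" "continuous_on S g"
  shows "continuous_on S (\<lambda>x. wedge (f x) (g x))"
  unfolding wedge_def by (intro continuous_intros assms)

lemma triangle_area: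
  "area (convex hull {a, b, c}) = \<bar>wedge (b - a) (c - a)\<bar> / 2"
proof -
  have "compact (convex hull {a, b, c})"
    by (simp add: compact_convex_hull finite_imp_compact)
  hence "area (convex hull {a, b, c}) = measure lborel (convex hull {a, b, c})"
    by (metis measure_completion borel_compact sets_lborel)
  also have "\<dots> = \<bar>wedge (b - a) (c - a)\<bar> / 2"
    unfolding content_triangle by (simp add: wedge_def abs_minus_commute algebra_simps)
  finally show ?thesis .
qed

lemma negligible_wedge:
  assumes "u \<noteq> 0"
  shows "negligible {x. wedge u x = 0}"
proof -
  have "turn u \<noteq> 0"
    using assms by (auto simp: turn_def vec_eq_iff forall_2)
  moreover have "{x. wedge u x = 0} = {x. turn u \<bullet> x = 0}"
    by (auto simp: turn_inner wedge_swap[of u])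
  ultimately show ?thesis by (simp add: negligible_hyperplane)
qed

text \<open>The sector swept out counterclockwise from \<open>u\<close> to \<open>v\<close> when \<open>wedge u v > 0\<close>. Leaving out the
  boundary rays costs no area and makes adjacent sectors disjoint.\<close>

definition sector :: "real^2 \<Rightarrow> real^2 \<Rightarrow> (real^2) set" where
  "sector u v = {x. 0 < wedge u x \<and> 0 < wedge x v}"

lemma open_sector: "open (sector u v)"
  unfolding sector_def by (intro open_Collect_conj open_Collect_less continuous_intros)

lemma sector_lmeasurable:
  assumes "compact C"
  shows "C \<inter> sector u v \<in> lmeasurable"
proof -
  have "sector u v \<in> sets lebesgue"
    using open_sector by (simp add: borel_open)
  thus ?thesis
    using lmeasurable_compact[OF assms] fmeasurable_Int_fmeasurable by blast
qed

lemma sector_mono_left: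
  assumes "0 < wedge u v" "0 < wedge v w" "0 < wedge u w"
  shows "sector u v \<subseteq> sector u w"
proof
  fix x assume "x \<in> sector u v"
  hence x: "0 < wedge u x" "0 < wedge x v" by (auto simp: sector_def)
  have "0 < wedge u x * wedge v w + wedge u w * wedge x v"
    using x assms by (intro add_pos_pos mult_pos_pos)
  hence "0 < wedge u v * wedge x w" by (simp only: wedge_three_term[of u v x w])
  thus "x \<in> sector u w" using x assms by (simp add: sector_def zero_less_mult_iff)
qed

lemma sector_mono_right:
  assumes "0 < wedge u v" "0 < wedge v w" "0 < wedge u w"
  shows "sector v w \<subseteq> sector u w"
proof
  fix x assume "x \<in> sector v w"
  hence x: "0 < wedge v x" "0 < wedge x w" by (auto simp: sector_def)
  have "wedge v w * wedge u x = wedge u v * wedge x w + wedge u w * wedge v x"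
    by (simp add: wedge_def algebra_simps)
  moreover have "0 < wedge u v * wedge x w + wedge u w * wedge v x"
    using x assms by (intro add_pos_pos mult_pos_pos)
  ultimately have "0 < wedge v w * wedge u x" by simp
  thus "x \<in> sector u w" using x assms by (simp add: sector_def zero_less_mult_iff)
qed

lemma sector_disjoint: "sector u v \<inter> sector v w = {}"
proof -
  have False if "0 < wedge x v" "0 < wedge v x" for x
    using that wedge_swap[of x v] by linarith
  thus ?thesis unfolding sector_def by blast
qed

lemma sector_area_split:
  assumes "compact C" "0 < wedge u v" "0 < wedge v w" "0 < wedge u w"
  shows "area (C \<inter> sector u v) + area (C \<inter> sector v w) \<le> area (C \<inter> sector u w)"
proof -
  have "(C \<inter> sector u v) \<inter> (C \<inter> sector v w) = {}"
    using sector_disjoint[of u v w] by blast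
  hence "area (C \<inter> sector u v) + area (C \<inter> sector v w)
      = area ((C \<inter> sector u v) \<union> (C \<inter> sector v w))"
    by (simp add: measure_Un3 sector_lmeasurable[OF assms(1)])
  also have "\<dots> \<le> area (C \<inter> sector u w)"
  proof (rule measure_mono_fmeasurable)
    show "(C \<inter> sector u v) \<union> (C \<inter> sector v w) \<subseteq> C \<inter> sector u w"
      using sector_mono_left[OF assms(2-4)] sector_mono_right[OF assms(2-4)] by blast
    show "(C \<inter> sector u v) \<union> (C \<inter> sector v w) \<in> sets lebesgue"
      by (intro sets.Un fmeasurableD sector_lmeasurable assms(1))
    show "C \<inter> sector u w \<in> lmeasurable" by (rule sector_lmeasurable[OF assms(1)])
  qed
  finally show ?thesis .
qed

lemma sector_area_three:
  assumes "compact C"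
  shows "area (C \<inter> sector u v) + area (C \<inter> sector v w) + area (C \<inter> sector w u) \<le> area C"
proof -
  let ?A = "C \<inter> sector u v" and ?B = "C \<inter> sector v w" and ?C = "C \<inter> sector w u"
  have m: "?A \<in> lmeasurable" "?B \<in> lmeasurable" "?C \<in> lmeasurable"
    by (rule sector_lmeasurable[OF assms])+
  have d: "?A \<inter> ?B = {}" "(?A \<union> ?B) \<inter> ?C = {}"
    using sector_disjoint[of u v w] sector_disjoint[of v w u] sector_disjoint[of w u v] by blast+
  have "area ?A + area ?B + area ?C = area (?A \<union> ?B \<union> ?C)"
    using m d by (simp add: measure_Un3 fmeasurable.Un)
  also have "\<dots> \<le> area C"
  proof (rule measure_mono_fmeasurable)
    show "?A \<union> ?B \<union> ?C \<subseteq> C" by blast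
    show "?A \<union> ?B \<union> ?C \<in> sets lebesgue" using m by (intro sets.Un fmeasurableD)
    show "C \<in> lmeasurable" by (rule lmeasurable_compact[OF assms])
  qed
  finally show ?thesis .
qed

lemma sector_area_ge_triangle:
  assumes "compact C" "convex C" "0 \<in> C" "u \<in> C" "v \<in> C" "0 < wedge u v"
  shows "wedge u v \<le> 2 * area (C \<inter> sector u v)"
proof -
  let ?T = "convex hull {0, u, v}"
  let ?N = "{x. wedge u x = 0} \<union> {x. wedge v x = 0}"
  have uv: "u \<noteq> 0" "v \<noteq> 0" using assms(6) by (auto simp: wedge_def)
  have "negligible ?N" by (intro negligible_Un negligible_wedge uv)
  have T: "compact ?T" by (simp add: compact_convex_hull finite_imp_compact)
  have "?T - ?N \<subseteq> C \<inter> sector u v"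
  proof
    fix x assume x: "x \<in> ?T - ?N"
    have "?T \<subseteq> C" using assms(2-5) by (simp add: hull_minimal)
    moreover from x obtain s t where st: "0 \<le> s" "0 \<le> t" "x = s *\<^sub>R u + t *\<^sub>R v"
      by (auto simp: convex_hull_3)
    hence "wedge u x = t * wedge u v" "wedge x v = s * wedge u v"
      by (simp_all add: wedge_algebra)
    moreover have "wedge u x \<noteq> 0" "wedge x v \<noteq> 0"
      using x wedge_swap[of x v] by auto
    ultimately show "x \<in> C \<inter> sector u v"
      using x st assms(6) by (auto simp: sector_def zero_less_mult_iff)
  qed
  hence "area (?T - ?N) \<le> area (C \<inter> sector u v)"
  proof (rule measure_mono_fmeasurable)
    show "?T - ?N \<in> sets lebesgue"
      by (intro sets.Diff fmeasurableD lmeasurable_compact T negligible_imp_sets)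
        (fact \<open>negligible ?N\<close>)
    show "C \<inter> sector u v \<in> lmeasurable" by (rule sector_lmeasurable[OF assms(1)])
  qed
  moreover have "area (?T - ?N) = area ?T"
    using \<open>negligible ?N\<close> fmeasurableD[OF lmeasurable_compact[OF T]]
    by (intro measure_Diff_null_set) (simp_all only: negligible_iff_null_sets)
  ultimately show ?thesis using assms(6) by (simp add: triangle_area)
qed

text \<open>If \<open>x\<close> lies in the sector, twice the area of the quadrilateral \<open>0, a, x, a'\<close> inside \<open>C\<close>
  appears on the left. Otherwise the supporting lines at \<open>a\<close> and \<open>a'\<close> keep \<open>x\<close> on the
  origin's side of the line through these points, and the triangle \<open>0, a, a'\<close> is large enough.\<close>

lemma wedge_edge_le_sector_area:
  assumes C: "compact C" "convex C" "0 \<in> C"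
    and a: "a \<in> C" "a' \<in> C" "0 < wedge a a'"
    and b: "\<And>x. x \<in> C \<Longrightarrow> x \<bullet> b \<le> 1" "\<And>x. x \<in> C \<Longrightarrow> x \<bullet> b' \<le> 1"
    and ab: "a \<bullet> b = 1" "a' \<bullet> b' = 1"
    and x: "x \<in> C"
  shows "wedge x (a' - a) \<le> 2 * area (C \<inter> sector a a')"
proof -
  define \<alpha> \<beta> where "\<alpha> = wedge x a' / wedge a a'" and "\<beta> = wedge a x / wedge a a'"
  have rep: "x = \<alpha> *\<^sub>R a + \<beta> *\<^sub>R a'"
    unfolding \<alpha>_def \<beta>_def using wedge_coordinates[of a a' x] a(3) by simp
  have val: "wedge x (a' - a) = (\<alpha> + \<beta>) * wedge a a'"
    by (simp add: rep wedge_algebra wedge_swap[of a' a] algebra_simps)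
  have tri: "wedge a a' \<le> 2 * area (C \<inter> sector a a')"
    by (rule sector_area_ge_triangle[OF C a])
  have *: "\<alpha> + \<beta> \<le> 1 \<Longrightarrow> ?thesis"
    using val tri a(3) mult_right_mono[of "\<alpha> + \<beta>" 1 "wedge a a'"] by linarith
  consider "\<alpha> \<le> 0" | "\<beta> \<le> 0" | "\<alpha> > 0" "\<beta> > 0" by linarith
  thus ?thesis
  proof cases
    case 1
    have "\<alpha> * (a \<bullet> b') + \<beta> \<le> 1"
      using b(2)[OF x] ab by (simp add: rep inner_add_left)
    moreover have "\<alpha> * 1 \<le> \<alpha> * (a \<bullet> b')"
      using 1 b(2)[OF a(1)] by (intro mult_left_mono_neg) auto
    ultimately show ?thesis using * by simp
  next
    case 2
    have "\<alpha> + \<beta> * (a' \<bullet> b) \<le> 1"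
      using b(1)[OF x] ab by (simp add: rep inner_add_left)
    moreover have "\<beta> * 1 \<le> \<beta> * (a' \<bullet> b)"
      using 2 b(1)[OF a(2)] by (intro mult_left_mono_neg) auto
    ultimately show ?thesis using * by simp
  next
    case 3
    have pos: "0 < wedge a x" "0 < wedge x a'"
      using 3 a(3) by (auto simp: rep wedge_algebra)
    have "wedge x (a' - a) = wedge a x + wedge x a'"
      by (simp add: wedge_algebra wedge_swap[of x a])
    also have "\<dots> \<le> 2 * area (C \<inter> sector a x) + 2 * area (C \<inter> sector x a')"
      using sector_area_ge_triangle[OF C a(1) x pos(1)] sector_area_ge_triangle[OF C x a(2) pos(2)]
      by linarith
    also have "\<dots> \<le> 2 * area (C \<inter> sector a a')"
      using sector_area_split[OF C(1) pos a(3)] by linarith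
    finally show ?thesis .
  qed
qed

lemma polar_inner_le: "b \<in> polar K \<Longrightarrow> y \<in> K \<Longrightarrow> y \<bullet> b \<le> 1"
  by (auto simp: polar_def inner_commute)

lemma convex_polar: "convex (polar K)"
  unfolding polar_def convex_alt
  by (auto simp: inner_add_left intro!: convex_bound_le)

lemma zero_in_polar [simp]: "0 \<in> polar K"
  by (simp add: polar_def)

lemma compact_polar:
  assumes "0 \<in> interior K"
  shows "compact (polar K)"
proof -
  obtain e where e: "0 < e" "cball 0 e \<subseteq> K"
    using assms mem_interior_cball by blast
  have "norm x \<le> 1 / e" if "x \<in> polar K" for x
  proof (cases "x = 0")
    case False
    have "(e / norm x) *\<^sub>R x \<in> K" using e False by (intro subsetD[OF e(2)]) simp
    hence "((e / norm x) *\<^sub>R x) \<bullet> x \<le> 1" using that polar_inner_le by blast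
    hence "e * norm x \<le> 1" using False by (simp add: dot_square_norm power2_eq_square)
    thus ?thesis using e(1) by (simp add: field_simps)
  qed (use e in auto)
  hence "bounded (polar K)" unfolding bounded_iff by blast
  moreover have "polar K = (\<Inter>y\<in>K. {x. x \<bullet> y \<le> 1})" by (auto simp: polar_def)
  hence "closed (polar K)"
    by (auto intro!: closed_Collect_le continuous_intros)
  ultimately show ?thesis by (simp add: compact_eq_bounded_closed)
qed

text \<open>The configuration of the key inequality: \<open>b\<close> and \<open>b'\<close> are normals of supporting lines of
  \<open>K\<close> at \<open>a\<close> and \<open>a'\<close>, scaled to be points of the polar body. The roles of \<open>K\<close> and of
  its polar are symmetric.\<close>

definition sector_duality :: "(real^2) set \<Rightarrow> real^2 \<Rightarrow> real^2 \<Rightarrow> real^2 \<Rightarrow> real^2 \<Rightarrow> bool" where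
  "sector_duality K a a' b b' \<longleftrightarrow> compact K \<and> convex K \<and> 0 \<in> interior K \<and>
     a \<in> K \<and> a' \<in> K \<and> b \<in> polar K \<and> b' \<in> polar K \<and> a \<bullet> b = 1 \<and> a' \<bullet> b' = 1 \<and>
     0 < wedge a a' \<and> 0 < wedge b b'"

lemma sector_duality_edge:
  assumes "sector_duality K a a' b b'"
  shows "x \<in> K \<Longrightarrow> wedge x (a' - a) \<le> 2 * area (K \<inter> sector a a')"
    and "y \<in> polar K \<Longrightarrow> wedge y (b' - b) \<le> 2 * area (polar K \<inter> sector b b')"
proof -
  have s: "compact K" "convex K" "0 \<in> interior K" "a \<in> K" "a' \<in> K" "b \<in> polar K" "b' \<in> polar K"
    "a \<bullet> b = 1" "a' \<bullet> b' = 1" "0 < wedge a a'" "0 < wedge b b'"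
    using assms by (auto simp: sector_duality_def)
  have "0 \<in> K" using s(3) interior_subset by blast
  show "wedge x (a' - a) \<le> 2 * area (K \<inter> sector a a')" if "x \<in> K"
    by (rule wedge_edge_le_sector_area[where b = b and b' = b'])
      (use s that \<open>0 \<in> K\<close> polar_inner_le in auto)
  show "wedge y (b' - b) \<le> 2 * area (polar K \<inter> sector b b')" if "y \<in> polar K"
    by (rule wedge_edge_le_sector_area[where b = a and b' = a'])
      (use s that compact_polar[OF s(3)] convex_polar in \<open>auto simp: polar_def inner_commute\<close>)
qed

text \<open>With \<open>p\<close> the area of the first sector, the edge inequality for \<open>K\<close> says that the vector
  \<open>turn (a' - a) / (2 * p)\<close> belongs to the polar body. Inserting it into the edge inequality for the
  polar sector couples the two areas.\<close>

lemma sector_product_ge: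
  assumes S: "sector_duality K a a' b b'"
  shows "2 - a \<bullet> b' - a' \<bullet> b \<le> 4 * area (K \<inter> sector a a') * area (polar K \<inter> sector b b')"
proof -
  define p where "p = area (K \<inter> sector a a')"
  have s: "a \<in> K" "0 < wedge a a'" "a \<bullet> b = 1" "a' \<bullet> b' = 1"
    using S by (auto simp: sector_duality_def)
  have "wedge a (a' - a) \<le> 2 * p" unfolding p_def by (rule sector_duality_edge(1)[OF S s(1)])
  hence p: "0 < p" using s(2) by (simp add: wedge_algebra)
  define y where "y = (1 / (2 * p)) *\<^sub>R turn (a' - a)"
  have "y \<in> polar K"
    unfolding polar_def y_def using sector_duality_edge(1)[OF S] p
    by (auto simp: turn_inner p_def[symmetric] field_simps)
  hence "wedge y (b' - b) \<le> 2 * area (polar K \<inter> sector b b')"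
    by (rule sector_duality_edge(2)[OF S])
  hence "(a' - a) \<bullet> (b' - b) \<le> 4 * p * area (polar K \<inter> sector b b')"
    using p by (simp add: y_def wedge_algebra(5) wedge_turn field_simps)
  thus ?thesis
    using s(3,4) by (simp add: p_def inner_diff_left inner_diff_right)
qed

section \<open>The farthest point of a sector\<close>

text \<open>Here \<open>P1, P2\<close> and \<open>Q1, Q2\<close> stand for the normalised areas of the two pieces of a sector and
  of its polar sector. The trivial bounds \<open>P1 + P2 \<ge> x\<close> and \<open>x * (Q1 + Q2) \<ge> B + B'\<close> alone give
  the factor 1. Either the first of them has a factor \<open>1 + \<gamma>\<close> to spare, or \<open>P1\<close> nearly attains its
  minimum, and then the lower bound for \<open>P1 * Q1\<close> pushes \<open>Q1\<close> above its minimum.\<close>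

lemma two_piece_gain:
  fixes x \<alpha> \<beta> B B' \<kappa> \<gamma> P1 P2 Q1 Q2 :: real
  assumes x: "x = \<alpha> + \<beta>" "0 < x" and P: "\<beta> \<le> P1" "\<alpha> \<le> P2" "0 < \<beta>"
    and Q: "B \<le> x * Q1" "B' \<le> x * Q2" and B: "0 < B" "0 < B'" and \<gamma>: "0 \<le> \<gamma>"
    and PQ: "B * \<beta> + (x - 1) * \<kappa> \<le> x * (P1 * Q1)"
    and gain: "\<gamma> * (x * B + \<beta> * (B + B') + x * \<gamma> * (B + B')) \<le> (x - 1) * \<kappa>"
  shows "(B + B') * (1 + \<gamma>) \<le> (P1 + P2) * (Q1 + Q2)"
proof -
  have "0 < Q1" "0 < Q2" using Q B x(2) by (smt (verit) zero_less_mult_pos)+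
  consider "x * (1 + \<gamma>) \<le> P1 + P2" | "P1 \<le> \<beta> + x * \<gamma>"
    using x P by (force simp: algebra_simps)
  thus ?thesis
  proof cases
    case 1
    have "(B + B') * (1 + \<gamma>) \<le> (x * (Q1 + Q2)) * (1 + \<gamma>)"
      using Q \<gamma> by (intro mult_right_mono) (auto simp: algebra_simps)
    also have "\<dots> = (x * (1 + \<gamma>)) * (Q1 + Q2)" by (simp add: algebra_simps)
    also have "\<dots> \<le> (P1 + P2) * (Q1 + Q2)"
      using 1 \<open>0 < Q1\<close> \<open>0 < Q2\<close> by (intro mult_right_mono) auto
    finally show ?thesis .
  next
    case 2
    \<comment> \<open>the first summand of \<open>x * (Q1 + Q2)\<close> has to gain for both, hence \<open>\<gamma> * (B + B')\<close>\<close>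
    have "(\<beta> + x * \<gamma>) * (B + \<gamma> * (B + B'))
        = B * \<beta> + \<gamma> * (x * B + \<beta> * (B + B') + x * \<gamma> * (B + B'))"
      by (simp add: algebra_simps)
    also have "\<dots> \<le> x * (P1 * Q1)" using PQ gain by simp
    also have "\<dots> \<le> (\<beta> + x * \<gamma>) * (x * Q1)"
      using 2 mult_right_mono[OF 2, of "x * Q1"] \<open>0 < Q1\<close> x(2) by (simp add: algebra_simps)
    finally have "B + \<gamma> * (B + B') \<le> x * Q1"
      by (rule mult_left_le_imp_le) (use P(3) x(2) \<gamma> in \<open>simp add: add_pos_nonneg\<close>)
    hence "(B + B') * (1 + \<gamma>) \<le> x * (Q1 + Q2)" using Q by (simp add: algebra_simps)
    also have "\<dots> \<le> (P1 + P2) * (Q1 + Q2)"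
      using P x \<open>0 < Q1\<close> \<open>0 < Q2\<close> by (intro mult_right_mono) auto
    finally show ?thesis .
  qed
qed

text \<open>The point of \<open>K\<close> farthest from the chord is \<open>\<alpha> *\<^sub>R a + \<beta> *\<^sub>R a'\<close>, at \<open>x\<close> times the distance of
  the chord from the origin. The supporting line there is parallel to the chord, and its normal
  divides the polar sector. The last conclusion results from applying the product inequality to both
  pairs of pieces; at least one of the two pieces has to produce a gain, because the amounts by which
  the farthest point stays inside the supporting lines at \<open>a\<close> and \<open>a'\<close> add up to at least
  \<open>2 - 61/100 * x\<close> when \<open>\<rho>\<close> is near 1.\<close>

lemma sector_farthest_point:
  assumes S: "sector_duality K a a' b b'"
    and \<rho>: "0 < \<rho>" "a' \<bullet> b = - \<rho> / 2" "a \<bullet> b' = - 1 / (2 * \<rho>)"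
  defines "D \<equiv> wedge a a'"
    and "p \<equiv> area (K \<inter> sector a a')" and "q \<equiv> area (polar K \<inter> sector b b')"
    and "s \<equiv> 2 + \<rho> / 2 + 1 / (2 * \<rho>)"
  obtains \<alpha> \<beta> x where "\<alpha> *\<^sub>R a + \<beta> *\<^sub>R a' \<in> K" "x = \<alpha> + \<beta>" "1 \<le> x"
    "\<And>y. y \<in> K \<Longrightarrow> wedge y (a' - a) \<le> x * D"
    "x * D \<le> 2 * p" "s \<le> 2 * q * (x * D)" "\<alpha> - \<rho> * \<beta> / 2 \<le> 1" "\<beta> - \<alpha> / (2 * \<rho>) \<le> 1"
    "\<And>\<gamma>. \<lbrakk>78/100 \<le> \<rho>; \<rho> \<le> 128/100; 0 \<le> \<gamma>;
        2 * x * s * (\<gamma> * (1 + \<gamma>)) \<le> (x - 1) * (2 - 61/100 * x)\<rbrakk> \<Longrightarrow> s * (1 + \<gamma>) \<le> 4 * p * q"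
proof -
  have sd: "compact K" "convex K" "0 \<in> interior K" "a \<in> K" "a' \<in> K" "b \<in> polar K" "b' \<in> polar K"
    "a \<bullet> b = 1" "a' \<bullet> b' = 1" "0 < D" "0 < wedge b b'"
    using S by (auto simp: sector_duality_def D_def)
  have zK: "0 \<in> K" using sd(3) interior_subset by blast
  have cp: "compact (polar K)" by (rule compact_polar[OF sd(3)])
  have "continuous_on K (\<lambda>y. wedge y (a' - a))" by (intro continuous_intros)
  then obtain d where d: "d \<in> K" "\<And>y. y \<in> K \<Longrightarrow> wedge y (a' - a) \<le> wedge d (a' - a)"
    using continuous_attains_sup[OF sd(1), of "\<lambda>y. wedge y (a' - a)"] zK by blast
  define \<alpha> \<beta> where "\<alpha> = wedge d a' / D" and "\<beta> = wedge a d / D"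
  define x where "x = \<alpha> + \<beta>"
  have drep: "d = \<alpha> *\<^sub>R a + \<beta> *\<^sub>R a'"
    unfolding \<alpha>_def \<beta>_def D_def using wedge_coordinates[of a a' d] sd(10) by (simp add: D_def)
  have wd: "wedge a d = \<beta> * D" "wedge d a' = \<alpha> * D"
    using sd(10) by (simp_all add: \<alpha>_def \<beta>_def)
  have wx: "wedge d (a' - a) = x * D"
    using wedge_swap[of d a] by (simp add: wedge_algebra wd x_def algebra_simps)
  have "wedge a (a' - a) \<le> x * D" using d(2)[OF sd(4)] wx by simp
  hence x1: "1 \<le> x" using sd(10) by (simp add: wedge_algebra D_def[symmetric])
  have pge: "x * D \<le> 2 * p" unfolding p_def wx[symmetric] by (rule sector_duality_edge(1)[OF S d(1)])
  have db: "d \<bullet> b = \<alpha> - \<rho> * \<beta> / 2" "d \<bullet> b' = \<beta> - \<alpha> / (2 * \<rho>)"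
    unfolding drep using sd(8,9) \<rho> by (simp_all add: inner_add_left)
  have db1: "\<alpha> - \<rho> * \<beta> / 2 \<le> 1" "\<beta> - \<alpha> / (2 * \<rho>) \<le> 1"
    using polar_inner_le[OF sd(6) d(1)] polar_inner_le[OF sd(7) d(1)] db by auto
  \<comment> \<open>the normal of the supporting line at \<open>d\<close>\<close>
  define c where "c = (1 / (x * D)) *\<^sub>R turn (a' - a)"
  have xD: "0 < x * D" using x1 sd(10) by simp
  have yc: "y \<bullet> c = wedge y (a' - a) / (x * D)" for y
    by (simp add: c_def inner_turn)
  have cK: "c \<in> polar K"
    using d(2) xD by (auto simp: polar_def inner_commute[of c] yc wx)
  have "wedge a (a' - a) = D" "wedge a' (a' - a) = D"
    by (simp_all add: wedge_algebra D_def wedge_swap[of a' a])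
  hence cs: "d \<bullet> c = 1" "a \<bullet> c = 1 / x" "a' \<bullet> c = 1 / x"
    using x1 sd(10) by (simp_all add: yc wx)
  define B B' where "B = 1 + \<rho> / 2" and "B' = 1 + 1 / (2 * \<rho>)"
  have BB: "0 < B" "0 < B'" "s = B + B'"
    using \<rho>(1) by (auto simp: B_def B'_def s_def add_pos_pos)
  have wbc: "D * wedge b c = B / x" "D * wedge c b' = B' / x"
    unfolding D_def wedge_inner_expand cs sd(8,9) \<rho>(2,3) using \<rho>(1) x1
    by (simp_all add: B_def B'_def field_simps)
  have wbc0: "0 < wedge b c" "0 < wedge c b'"
    using wbc sd(10) BB x1 by (metis divide_pos_pos less_le_trans zero_less_mult_pos zero_less_one)+
  define p1 p2 q1 q2 where "p1 = area (K \<inter> sector a d)" and "p2 = area (K \<inter> sector d a')"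
    and "q1 = area (polar K \<inter> sector b c)" and "q2 = area (polar K \<inter> sector c b')"
  have q12: "q1 + q2 \<le> q"
    unfolding q1_def q2_def q_def by (rule sector_area_split[OF cp wbc0 sd(11)])
  have q1: "wedge b c \<le> 2 * q1" and q2: "wedge c b' \<le> 2 * q2"
    unfolding q1_def q2_def
    by (rule sector_area_ge_triangle[OF cp convex_polar zero_in_polar]; fact sd cK wbc0)+
  have xq: "B \<le> x * (2 * q1 * D)" "B' \<le> x * (2 * q2 * D)"
    using mult_left_mono[OF q1, of D] mult_left_mono[OF q2, of D] wbc sd(10) x1
    by (simp_all add: field_simps)
  have sq: "s \<le> 2 * q * (x * D)"
  proof -
    have "s \<le> x * D * (2 * (q1 + q2))" using xq BB(3) by (simp add: algebra_simps)
    also have "\<dots> \<le> x * D * (2 * q)" using q12 xD by (intro mult_left_mono) auto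
    finally show ?thesis by (simp add: algebra_simps)
  qed
  have gain: "s * (1 + \<gamma>) \<le> 4 * p * q"
    if g: "78/100 \<le> \<rho>" "\<rho> \<le> 128/100" "0 \<le> \<gamma>"
      "2 * x * s * (\<gamma> * (1 + \<gamma>)) \<le> (x - 1) * (2 - 61/100 * x)" for \<gamma>
  proof (cases "x = 1")
    case True
    have "\<gamma> = 0"
    proof (rule ccontr)
      assume "\<gamma> \<noteq> 0"
      hence "0 < 2 * x * s * (\<gamma> * (1 + \<gamma>))" using g(3) BB True by (intro mult_pos_pos) auto
      thus False using g(4) True by simp
    qed
    moreover have "s = 2 - a \<bullet> b' - a' \<bullet> b" using \<rho> by (simp add: s_def)
    ultimately show ?thesis
      using sector_product_ge[OF S] by (simp add: p_def q_def)
  next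
    case False
    hence x1': "1 < x" using x1 by simp
    have \<beta>: "0 < \<beta>"
    proof (rule ccontr)
      assume "\<not> 0 < \<beta>"
      hence "\<rho> * \<beta> \<le> 0" using \<rho>(1) by (simp add: mult_nonneg_nonpos)
      thus False using db1(1) x1' \<open>\<not> 0 < \<beta>\<close> by (simp add: x_def)
    qed
    have \<alpha>: "0 < \<alpha>"
    proof (rule ccontr)
      assume "\<not> 0 < \<alpha>"
      hence "\<alpha> / (2 * \<rho>) \<le> 0" using \<rho>(1) by (simp add: divide_nonpos_pos)
      thus False using db1(2) x1' \<open>\<not> 0 < \<alpha>\<close> by (simp add: x_def)
    qed
    have wd0: "0 < wedge a d" "0 < wedge d a'" using wd \<alpha> \<beta> sd(10) by simp_all
    have S1: "sector_duality K a d b c" and S2: "sector_duality K d a' c b'"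
      using sd d(1) cK cs(1) wd0 wbc0 by (simp_all add: sector_duality_def)
    have p12: "p1 + p2 \<le> p"
      unfolding p1_def p2_def p_def
      by (rule sector_area_split[OF sd(1) wd0]) (use sd(10) in \<open>simp add: D_def\<close>)
    have "wedge a d \<le> 2 * p1" "wedge d a' \<le> 2 * p2"
      unfolding p1_def p2_def
      by (rule sector_area_ge_triangle[OF sd(1,2) zK]; fact sd d wd0)+
    hence xp: "\<beta> \<le> 2 * p1 / D" "\<alpha> \<le> 2 * p2 / D"
      using sd(10) by (simp_all add: wd field_simps)
    \<comment> \<open>the first summand will be the trivial bound, the second is the gain: excess height times slack of a supporting line\<close>
    have k: "x * (2 - 1 / x - y) = (x - 1 + (1 - y)) + (x - 1) * (1 - y)" for y
      using x1 by (simp add: field_simps)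
    have k1: "x * (2 - 1 / x - (\<alpha> - \<rho> * \<beta> / 2)) = B * \<beta> + (x - 1) * (1 - (\<alpha> - \<rho> * \<beta> / 2))"
      unfolding k by (simp add: B_def x_def distrib_right)
    have k2: "x * (2 - 1 / x - (\<beta> - \<alpha> / (2 * \<rho>)))
        = B' * \<alpha> + (x - 1) * (1 - (\<beta> - \<alpha> / (2 * \<rho>)))"
      unfolding k by (simp add: B'_def x_def distrib_right)
    have "2 - 1 / x - (\<alpha> - \<rho> * \<beta> / 2) \<le> 4 * p1 * q1" "2 - 1 / x - (\<beta> - \<alpha> / (2 * \<rho>)) \<le> 4 * p2 * q2"
      using sector_product_ge[OF S1] sector_product_ge[OF S2] cs db
      by (simp_all add: p1_def p2_def q1_def q2_def algebra_simps)
    hence "x * (2 - 1 / x - (\<alpha> - \<rho> * \<beta> / 2)) \<le> x * (4 * p1 * q1)"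
      "x * (2 - 1 / x - (\<beta> - \<alpha> / (2 * \<rho>))) \<le> x * (4 * p2 * q2)"
      using x1 by (auto intro!: mult_left_mono)
    moreover have "4 * p1 * q1 = (2 * p1 / D) * (2 * q1 * D)" "4 * p2 * q2 = (2 * p2 / D) * (2 * q2 * D)"
      using sd(10) by simp_all
    ultimately have PQ1: "B * \<beta> + (x - 1) * (1 - (\<alpha> - \<rho> * \<beta> / 2)) \<le> x * ((2 * p1 / D) * (2 * q1 * D))"
      and PQ2: "B' * \<alpha> + (x - 1) * (1 - (\<beta> - \<alpha> / (2 * \<rho>))) \<le> x * ((2 * p2 / D) * (2 * q2 * D))"
      unfolding k1 k2 by simp_all
    \<comment> \<open>\<open>\<rho>\<close> and \<open>1 / \<rho>\<close> are both at least \<open>78/100\<close>\<close>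
    have "39/100 * x \<le> \<rho> * \<beta> / 2 + \<alpha> / (2 * \<rho>)"
    proof -
      have "39/100 * \<beta> \<le> \<rho> / 2 * \<beta>" using g(1) \<beta> by (intro mult_right_mono) auto
      moreover have "39/100 * \<alpha> \<le> 1 / (2 * \<rho>) * \<alpha>"
        using g(2) \<rho>(1) \<alpha> by (intro mult_right_mono) (auto simp: field_simps)
      ultimately show ?thesis by (simp add: x_def algebra_simps)
    qed
    hence "2 - 61/100 * x \<le> (1 - (\<alpha> - \<rho> * \<beta> / 2)) + (1 - (\<beta> - \<alpha> / (2 * \<rho>)))"
      using x_def by linarith
    hence "(x - 1) * (2 - 61/100 * x)
        \<le> (x - 1) * ((1 - (\<alpha> - \<rho> * \<beta> / 2)) + (1 - (\<beta> - \<alpha> / (2 * \<rho>))))"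
      using x1 by (intro mult_left_mono) auto
    moreover have "\<gamma> * (x * B + \<beta> * (B + B') + x * \<gamma> * (B + B'))
        + \<gamma> * (x * B' + \<alpha> * (B' + B) + x * \<gamma> * (B' + B)) = 2 * x * s * (\<gamma> * (1 + \<gamma>))"
      unfolding BB(3) x_def by (simp add: algebra_simps)
    ultimately consider
      "\<gamma> * (x * B + \<beta> * (B + B') + x * \<gamma> * (B + B')) \<le> (x - 1) * (1 - (\<alpha> - \<rho> * \<beta> / 2))"
      | "\<gamma> * (x * B' + \<alpha> * (B' + B) + x * \<gamma> * (B' + B)) \<le> (x - 1) * (1 - (\<beta> - \<alpha> / (2 * \<rho>)))"
      using g(4) unfolding distrib_left[of "x - 1"] by linarith
    hence "s * (1 + \<gamma>) \<le> (2 * p1 / D + 2 * p2 / D) * (2 * q1 * D + 2 * q2 * D)"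
    proof cases
      case 1
      show ?thesis unfolding BB(3)
        by (rule two_piece_gain[OF x_def _ xp \<beta> xq BB(1,2) g(3) PQ1 1]) (use x1 in simp)
    next
      case 2
      have "(B' + B) * (1 + \<gamma>) \<le> (2 * p2 / D + 2 * p1 / D) * (2 * q2 * D + 2 * q1 * D)"
        by (rule two_piece_gain[OF _ _ xp(2,1) \<alpha> xq(2,1) BB(2,1) g(3) PQ2 2])
          (use x1 in \<open>simp_all add: x_def\<close>)
      thus ?thesis unfolding BB(3) by (simp add: add.commute)
    qed
    also have "\<dots> = 4 * (p1 + p2) * (q1 + q2)" using sd(10) by (simp add: field_simps)
    also have "\<dots> \<le> 4 * p * q"
      using p12 q12 by (intro mult_mono) (auto simp: p_def p1_def p2_def q1_def q2_def q_def)
    finally show ?thesis .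
  qed
  show ?thesis
    by (rule that[of \<alpha> \<beta> x]) (use drep d wx x1 pge sq db1 gain in \<open>auto simp: x_def\<close>)
qed

section \<open>Balanced triangles\<close>

text \<open>Maximising the product of the three determinants, rather than the area of the triangle, keeps the
  origin inside the triangle and gives first-order conditions adapted to the sectors.\<close>

definition balanced_triangle :: "(real^2) set \<Rightarrow> real^2 \<Rightarrow> real^2 \<Rightarrow> real^2 \<Rightarrow> bool" where
  "balanced_triangle K a b c \<longleftrightarrow> a \<in> K \<and> b \<in> K \<and> c \<in> K \<and>
     0 < wedge b c \<and> 0 < wedge c a \<and> 0 < wedge a b \<and>
     (\<forall>x\<in>K. \<forall>y\<in>K. \<forall>z\<in>K. 0 < wedge y z \<longrightarrow> 0 < wedge z x \<longrightarrow> 0 < wedge x y \<longrightarrow>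
        wedge y z * wedge z x * wedge x y \<le> wedge b c * wedge c a * wedge a b)"

lemma balanced_triangle_rotate:
  assumes "balanced_triangle K a b c"
  shows "balanced_triangle K b c a"
proof -
  have "wedge y z * wedge z x * wedge x y \<le> wedge c a * wedge a b * wedge b c"
    if "x \<in> K" "y \<in> K" "z \<in> K" "0 < wedge y z" "0 < wedge z x" "0 < wedge x y" for x y z
  proof -
    have "wedge y z * wedge z x * wedge x y \<le> wedge b c * wedge c a * wedge a b"
      using assms that unfolding balanced_triangle_def by blast
    thus ?thesis by (simp add: mult_ac)
  qed
  thus ?thesis using assms unfolding balanced_triangle_def by blast
qed

lemma compact_attains_sup_three:
  fixes f :: "'a::topological_space \<Rightarrow> 'a \<Rightarrow> 'a \<Rightarrow> real"
  assumes "compact K" "K \<noteq> {}" "continuous_on (K \<times> K \<times> K) (\<lambda>(x, y, z). f x y z)"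
  obtains a b c where "a \<in> K" "b \<in> K" "c \<in> K"
    "\<And>x y z. x \<in> K \<Longrightarrow> y \<in> K \<Longrightarrow> z \<in> K \<Longrightarrow> f x y z \<le> f a b c"
proof -
  have "compact (K \<times> K \<times> K)" using assms(1) by (intro compact_Times)
  moreover have "K \<times> K \<times> K \<noteq> {}" using assms(2) by auto
  ultimately obtain w where w: "w \<in> K \<times> K \<times> K"
    "\<And>v. v \<in> K \<times> K \<times> K \<Longrightarrow> (\<lambda>(x, y, z). f x y z) v \<le> (\<lambda>(x, y, z). f x y z) w"
    using continuous_attains_sup[OF _ _ assms(3)] by blast
  obtain a b c where abc: "w = (a, b, c)" by (cases w)
  show ?thesis
  proof (rule that[of a b c])
    fix x y z assume "x \<in> K" "y \<in> K" "z \<in> K"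
    thus "f x y z \<le> f a b c" using w(2)[of "(x, y, z)"] by (simp add: abc)
  qed (use w(1) in \<open>simp_all add: abc\<close>)
qed

text \<open>Truncating the determinants at 0 turns the constrained maximum into one of a continuous function on
  a compact set; it is positive because \<open>K\<close> contains a small triangle around the origin.\<close>

lemma balanced_triangle_exists:
  assumes "compact K" "0 \<in> interior K"
  obtains a b c where "balanced_triangle K a b c"
proof -
  define h where "h x y z = max 0 (wedge y z) * max 0 (wedge z x) * max 0 (wedge x y)"
    for x y z :: "real^2"
  have "continuous_on (K \<times> K \<times> K) (\<lambda>(x, y, z). h x y z)"
    unfolding h_def case_prod_unfold by (intro continuous_intros)
  moreover have "K \<noteq> {}" using assms(2) by auto
  ultimately obtain a b c where abc: "a \<in> K" "b \<in> K" "c \<in> K"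
    and max: "\<And>x y z. x \<in> K \<Longrightarrow> y \<in> K \<Longrightarrow> z \<in> K \<Longrightarrow> h x y z \<le> h a b c"
    using compact_attains_sup_three[OF assms(1), of h] by metis
  obtain e where e: "0 < e" "cball 0 e \<subseteq> K"
    using assms(2) mem_interior_cball by blast
  define x y z :: "real^2" where "x = (e/2) *\<^sub>R vector [1, 0]"
    and "y = (e/2) *\<^sub>R vector [-1, 1]" and "z = (e/2) *\<^sub>R vector [-1, -1]"
  have n: "norm (vector [u, v] :: real^2) \<le> \<bar>u\<bar> + \<bar>v\<bar>" for u v :: real
    using norm_le_l1_cart[of "vector [u, v] :: real^2"] by (simp add: sum_2)
  have "norm (vector [1, 0] :: real^2) \<le> 2" "norm (vector [-1, 1] :: real^2) \<le> 2"
    "norm (vector [-1, -1] :: real^2) \<le> 2"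
    using n[of 1 0] n[of "-1" 1] n[of "-1" "-1"] by simp_all
  hence "x \<in> cball 0 e" "y \<in> cball 0 e" "z \<in> cball 0 e"
    using e(1) by (simp_all add: x_def y_def z_def field_simps)
  hence "h x y z \<le> h a b c" using max e(2) by blast
  moreover have "0 < h x y z"
    using e(1) by (simp add: h_def x_def y_def z_def wedge_def)
  ultimately have pos: "0 < h a b c" by simp
  have D: "0 < wedge b c" "0 < wedge c a" "0 < wedge a b"
    using pos unfolding h_def by (auto simp: max_def zero_less_mult_iff split: if_splits)
  have "balanced_triangle K a b c"
    unfolding balanced_triangle_def
  proof (intro conjI ballI impI abc D)
    fix x y z assume "x \<in> K" "y \<in> K" "z \<in> K" "0 < wedge y z" "0 < wedge z x" "0 < wedge x y"
    thus "wedge y z * wedge z x * wedge x y \<le> wedge b c * wedge c a * wedge a b"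
      using max[of x y z] D by (simp add: h_def max_def)
  qed
  thus ?thesis by (rule that)
qed

text \<open>Half the gradient, with respect to \<open>a\<close>, of the logarithm of the product that a balanced triangle
  maximises.\<close>

definition dual_vertex :: "real^2 \<Rightarrow> real^2 \<Rightarrow> real^2 \<Rightarrow> real^2" where
  "dual_vertex a b c = (1/2) *\<^sub>R ((1 / wedge a b) *\<^sub>R turn b - (1 / wedge c a) *\<^sub>R turn c)"

lemma inner_dual_vertex:
  "x \<bullet> dual_vertex a b c = (wedge x b / wedge a b + wedge c x / wedge c a) / 2"
  using wedge_swap[of x c] by (simp add: dual_vertex_def inner_diff_right inner_turn)

text \<open>Moving \<open>a\<close> slightly towards a point \<open>x\<close> of \<open>K\<close> must not increase the product; to first
  order this says that \<open>x\<close> lies on the inner side of the line with normal \<open>dual_vertex a b c\<close>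
  through \<open>a\<close>.\<close>

lemma dual_vertex_in_polar:
  assumes "convex K" and bal: "balanced_triangle K a b c"
  shows "dual_vertex a b c \<in> polar K"
proof -
  have s: "a \<in> K" "b \<in> K" "c \<in> K" "0 < wedge b c" "0 < wedge c a" "0 < wedge a b"
    using bal by (auto simp: balanced_triangle_def)
  have "x \<bullet> dual_vertex a b c \<le> 1" if x: "x \<in> K" for x
  proof (rule ccontr)
    define u v where "u = wedge x b / wedge a b - 1" and "v = wedge c x / wedge c a - 1"
    assume "\<not> x \<bullet> dual_vertex a b c \<le> 1"
    hence uv: "0 < u + v" by (simp add: inner_dual_vertex u_def v_def)
    \<comment> \<open>\<open>1 / M\<close> is a step small enough for the first-order term to dominate and both determinants to stay positive\<close>
    define M where "M = 2 + \<bar>u\<bar> + \<bar>v\<bar> + \<bar>u * v\<bar> / (u + v)"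
    define t where "t = 1 / M"
    have M: "2 \<le> M" "\<bar>u\<bar> < M" "\<bar>v\<bar> < M" "\<bar>u * v\<bar> / (u + v) < M"
      unfolding M_def using uv by (auto simp: add_nonneg_pos add_pos_nonneg add_strict_increasing)
    have t: "0 < t" "t \<le> 1" "\<bar>t * u\<bar> < 1" "\<bar>t * v\<bar> < 1" "\<bar>t * (u * v)\<bar> < u + v"
      unfolding t_def using M uv by (auto simp: abs_mult field_simps)
    define z where "z = (1 - t) *\<^sub>R a + t *\<^sub>R x"
    have "z \<in> K" unfolding z_def using t s(1) x assms(1) by (intro convexD_alt) auto
    have z: "wedge z b = wedge a b * (1 + t * u)" "wedge c z = wedge c a * (1 + t * v)"
      unfolding z_def u_def v_def using s by (simp_all add: wedge_algebra field_simps)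
    have pos: "0 < 1 + t * u" "0 < 1 + t * v" using t by linarith+
    have "wedge b c * wedge c z * wedge z b \<le> wedge b c * wedge c a * wedge a b"
      using bal \<open>z \<in> K\<close> s z pos unfolding balanced_triangle_def
      by (metis mult_pos_pos)
    hence "(wedge b c * wedge c a * wedge a b) * ((1 + t * u) * (1 + t * v))
        \<le> (wedge b c * wedge c a * wedge a b) * 1"
      by (simp add: z mult_ac)
    hence "(1 + t * u) * (1 + t * v) \<le> 1"
      using s by (simp only: mult_le_cancel_left_pos mult_pos_pos)
    hence "t * (u + v + t * (u * v)) \<le> 0" by (simp add: algebra_simps)
    hence "u + v + t * (u * v) \<le> 0" using t(1) by (simp add: mult_le_0_iff)
    thus False using t(5) by linarith
  qed
  thus ?thesis by (simp add: polar_def inner_commute)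
qed

text \<open>With \<open>\<rho> = wedge b c / wedge c a\<close> the two mixed inner products are \<open>- \<rho> / 2\<close> and \<open>- 1 / (2 * \<rho>)\<close>.
  The product inequality thus has the lower bound \<open>2 + \<rho> / 2 + 1 / (2 * \<rho>) \<ge> 3\<close>, the value for
  a triangle with its centroid at the origin.\<close>

lemma balanced_sector_duality:
  assumes K: "compact K" "convex K" "0 \<in> interior K" and bal: "balanced_triangle K a b c"
  shows "sector_duality K a b (dual_vertex a b c) (dual_vertex b c a)"
    and "b \<bullet> dual_vertex a b c = - (wedge b c / wedge c a) / 2"
    and "a \<bullet> dual_vertex b c a = - 1 / (2 * (wedge b c / wedge c a))"
proof -
  have s: "a \<in> K" "b \<in> K" "0 < wedge b c" "0 < wedge c a" "0 < wedge a b"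
    using bal by (auto simp: balanced_triangle_def)
  show 1: "b \<bullet> dual_vertex a b c = - (wedge b c / wedge c a) / 2"
    using wedge_swap[of c b] by (simp add: inner_dual_vertex)
  show 2: "a \<bullet> dual_vertex b c a = - 1 / (2 * (wedge b c / wedge c a))"
    using wedge_swap[of a c] by (simp add: inner_dual_vertex)
  have 3: "a \<bullet> dual_vertex a b c = 1" "b \<bullet> dual_vertex b c a = 1"
    using s by (simp_all add: inner_dual_vertex)
  have "wedge a b * wedge (dual_vertex a b c) (dual_vertex b c a) = 3/4"
    unfolding wedge_inner_expand 1 2 3 using s by (simp add: field_simps)
  hence "0 < wedge (dual_vertex a b c) (dual_vertex b c a)"
    using s(5) by (metis divide_pos_pos zero_less_mult_pos zero_less_numeral)
  thus "sector_duality K a b (dual_vertex a b c) (dual_vertex b c a)"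
    unfolding sector_duality_def
    using K s 3 dual_vertex_in_polar[OF K(2) bal]
      dual_vertex_in_polar[OF K(2) balanced_triangle_rotate[OF bal]] by blast
qed

section \<open>Numerical inequalities\<close>

lemma am_gm_three:
  fixes x y z :: real
  assumes "0 \<le> x" "0 \<le> y" "0 \<le> z"
  shows "27 * (x * y * z) \<le> (x + y + z)^3"
proof -
  have "2 * (x + y + z)^3 = 54 * (x * y * z)
      + (x + y + z) * ((x - y)\<^sup>2 + (y - z)\<^sup>2 + (z - x)\<^sup>2)
      + 6 * (x * (y - z)\<^sup>2 + y * (z - x)\<^sup>2 + z * (x - y)\<^sup>2)"
    by (simp add: power2_eq_square power3_eq_cube algebra_simps)
  moreover have "0 \<le> (x + y + z) * ((x - y)\<^sup>2 + (y - z)\<^sup>2 + (z - x)\<^sup>2)"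
    "0 \<le> 6 * (x * (y - z)\<^sup>2 + y * (z - x)\<^sup>2 + z * (x - y)\<^sup>2)"
    using assms by simp_all
  ultimately show ?thesis by linarith
qed

lemma product_of_sums_ge:
  fixes p1 p2 p3 q1 q2 q3 :: real
  assumes "0 \<le> p1" "0 \<le> p2" "0 \<le> p3" "0 \<le> q1" "0 \<le> q2" "0 \<le> q3"
  shows "27 * 27 * ((p1 * q1) * (p2 * q2) * (p3 * q3))
      \<le> ((p1 + p2 + p3) * (q1 + q2 + q3))^3"
proof -
  have "(27 * (p1 * p2 * p3)) * (27 * (q1 * q2 * q3)) \<le> (p1 + p2 + p3)^3 * (q1 + q2 + q3)^3"
    using assms by (intro mult_mono am_gm_three) simp_all
  thus ?thesis by (simp add: power_mult_distrib mult_ac)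
qed

lemma near_one_if_sum_reciprocal_small:
  fixes \<rho> :: real
  assumes "0 < \<rho>" "\<rho> / 2 + 1 / (2 * \<rho>) \<le> 10302/10000"
  shows "78/100 \<le> \<rho>" "\<rho> \<le> 128/100"
proof -
  have "\<rho> * (\<rho> / 2 + 1 / (2 * \<rho>)) \<le> \<rho> * (10302/10000)"
    using assms by (intro mult_left_mono) auto
  moreover have "\<rho> * (\<rho> / 2 + 1 / (2 * \<rho>)) = (\<rho> * \<rho> + 1) / 2"
    using assms(1) by (simp add: field_simps)
  ultimately have q: "\<rho> * \<rho> + 1 \<le> 20604/10000 * \<rho>" by simp
  have "(\<rho> - 78/100) * (\<rho> - 12804/10000) < 0" "(\<rho> - 128/100) * (\<rho> - 7804/10000) < 0"
  proof -
    have e: "(\<rho> - 78/100) * (\<rho> - 12804/10000) = \<rho> * \<rho> - 20604/10000 * \<rho> + 998712/1000000"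
      "(\<rho> - 128/100) * (\<rho> - 7804/10000) = \<rho> * \<rho> - 20604/10000 * \<rho> + 998912/1000000"
      by (simp_all add: field_simps)
    show "(\<rho> - 78/100) * (\<rho> - 12804/10000) < 0" "(\<rho> - 128/100) * (\<rho> - 7804/10000) < 0"
      unfolding e using q by simp_all
  qed
  thus "78/100 \<le> \<rho>" "\<rho> \<le> 128/100"
    by (auto simp: mult_less_0_iff)
qed

lemma sum_reciprocal_ge_2:
  fixes \<rho> :: real
  assumes "0 < \<rho>"
  shows "1 \<le> \<rho> / 2 + 1 / (2 * \<rho>)"
proof -
  have "\<rho> / 2 + 1 / (2 * \<rho>) - 1 = (\<rho> - 1)\<^sup>2 / (2 * \<rho>)"
    using assms by (simp add: field_simps power2_eq_square)
  moreover have "0 \<le> (\<rho> - 1)\<^sup>2 / (2 * \<rho>)" using assms by simp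
  ultimately show ?thesis by linarith
qed

text \<open>Since \<open>g\<close> exceeds 3 by barely one per cent, no gain of \<open>\<gamma> = 101/10000\<close> is possible, whereas
  the premise for this gain holds at all heights strictly between \<open>105/100\<close> and \<open>31/10\<close>. At the
  small heights the premise holds for \<open>\<gamma> = (x - 1) / 5\<close>, which makes the excess of \<open>g\<close> over 3
  at least linear in \<open>x - 1\<close>.\<close>

lemma height_dichotomy:
  fixes x s g :: real
  assumes x: "1 \<le> x" and s: "3 \<le> s" "s \<le> g" and g: "g \<le> 30302/10000"
    and gain: "\<And>\<gamma>. \<lbrakk>0 \<le> \<gamma>; 2 * x * s * (\<gamma> * (1 + \<gamma>)) \<le> (x - 1) * (2 - 61/100 * x)\<rbrakk>
      \<Longrightarrow> s * (1 + \<gamma>) \<le> g"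
  shows "x \<le> 105/100 \<or> 31/10 \<le> x"
    and "x \<le> 105/100 \<Longrightarrow> 1 + (x - 1) / 5 \<le> g / 3"
proof -
  have s': "s \<le> 30302/10000" using s g by simp
  show "x \<le> 105/100 \<or> 31/10 \<le> x"
  proof (rule ccontr)
    assume "\<not> ?thesis"
    hence xx: "105/100 < x" "x < 31/10" by auto
    have "2 * x * s * (101/10000 * (1 + 101/10000)) \<le> 2 * x * (30302/10000) * (101/10000 * (1 + 101/10000))"
      using x s' by (intro mult_right_mono mult_left_mono) auto
    also have "\<dots> \<le> (x - 1) * (2 - 61/100 * x)"
    proof -
      have "0 \<le> (x - 105/100) * (31/10 - x)" using xx by simp
      also have "\<dots> = 415/100 * x - x\<^sup>2 - 3255/1000"
        by (simp add: power2_eq_square field_simps)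
      finally have "x\<^sup>2 \<le> 415/100 * x - 3255/1000" by simp
      moreover have "(x - 1) * (2 - 61/100 * x) = 261/100 * x - 61/100 * x\<^sup>2 - 2"
        by (simp add: power2_eq_square field_simps)
      ultimately show ?thesis using x by simp
    qed
    finally have "s * (1 + 101/10000) \<le> g" using gain[of "101/10000"] by simp
    thus False using s g by simp
  qed
  assume xs: "x \<le> 105/100"
  define r where "r = x - 1"
  have r: "0 \<le> r" "r \<le> 5/100" using x xs by (auto simp: r_def)
  have "2 * x * s * (r/5 * (1 + r/5)) \<le> (2 * (105/100) * (30302/10000)) * (r/5 * (1 + 1/100))"
    using x xs s s' r by (intro mult_mono) auto
  also have "\<dots> \<le> r * (2 - 61/100 * (105/100))" using r by simp
  also have "\<dots> \<le> r * (2 - 61/100 * x)" using r xs by (intro mult_left_mono) auto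
  finally have "s * (1 + r/5) \<le> g" using gain[of "r/5"] r by (simp add: r_def)
  moreover have "3 * (1 + r/5) \<le> s * (1 + r/5)" using s r by (intro mult_right_mono) auto
  ultimately have "3 * (1 + r/5) \<le> g" by (rule order_trans[rotated])
  thus "1 + (x - 1) / 5 \<le> g / 3" unfolding r_def[symmetric] by (simp add: divide_simps)
qed

text \<open>The product of the sums is at least 9, with equality for equal weights only; a ratio of at least 2
  between two weights raises it by at least \<open>1/2\<close>.\<close>

lemma reciprocal_weights_ratio:
  fixes z1 z2 z3 :: real
  assumes z: "0 < z1" "0 < z2" "0 < z3"
    and le: "(z1 + z2 + z3) * (1/z1 + 1/z2 + 1/z3) < 19/2"
  shows "z1 < 2 * z2"
proof (rule ccontr)
  assume "\<not> ?thesis"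
  hence c: "2 * z2 \<le> z1" by simp
  have two: "2 \<le> u / v + v / u" if "0 < u" "0 < v" for u v :: real
  proof -
    have "u / v + v / u - 2 = (u - v)\<^sup>2 / (u * v)"
      using that by (simp add: field_simps power2_eq_square)
    moreover have "0 \<le> (u - v)\<^sup>2 / (u * v)" using that by simp
    ultimately show ?thesis by linarith
  qed
  have "z1 / z2 + z2 / z1 - 5/2 = (z1 - 2 * z2) * (2 * z1 - z2) / (2 * z1 * z2)"
    using z by (simp add: field_simps)
  moreover have "0 \<le> (z1 - 2 * z2) * (2 * z1 - z2) / (2 * z1 * z2)"
    using z c by (intro divide_nonneg_pos mult_nonneg_nonneg) auto
  ultimately have "5/2 \<le> z1 / z2 + z2 / z1" by linarith
  moreover have "(z1 + z2 + z3) * (1/z1 + 1/z2 + 1/z3)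
      = 3 + (z1 / z2 + z2 / z1) + (z1 / z3 + z3 / z1) + (z2 / z3 + z3 / z2)"
    using z by (simp add: field_simps)
  ultimately show False using le two[OF z(1,3)] two[OF z(2,3)] by linarith
qed

text \<open>The expression is the ratio of the determinant of two far points, in adjacent sectors, to the
  determinant of two vertices of the balanced triangle. It could only be
  small if both points leant away from the common vertex of their sectors, and this is what the
  supporting lines at the other two vertices exclude.\<close>

lemma far_points_span_more:
  fixes s t \<alpha>1 \<beta>1 \<alpha>2 \<beta>2 :: real
  assumes s: "78/100 \<le> s" and t: "78/100 \<le> t"
    and x: "31/10 \<le> \<alpha>1 + \<beta>1" "31/10 \<le> \<alpha>2 + \<beta>2"
    and 1: "\<alpha>1 - t * \<beta>1 / 2 \<le> 1" "\<beta>1 - \<alpha>1 / (2 * t) \<le> 1"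
    and 2: "\<beta>2 - s * \<alpha>2 / 2 \<le> 1" "\<alpha>2 - \<beta>2 / (2 * s) \<le> 1"
  shows "1 < s * (\<alpha>1 * \<alpha>2) - \<alpha>1 * \<beta>2 + t * (\<beta>1 * \<beta>2)"
proof -
  \<comment> \<open>in these variables the claim is linear in \<open>w\<close>, with coefficient \<open>\<alpha>1\<close> bounded by \<open>1 + u / 2\<close>\<close>
  define u w where "u = t * \<beta>1" and "w = s * \<alpha>2"
  have expr: "s * (\<alpha>1 * \<alpha>2) - \<alpha>1 * \<beta>2 + t * (\<beta>1 * \<beta>2) = \<alpha>1 * (w - \<beta>2) + u * \<beta>2"
    by (simp add: u_def w_def algebra_simps)
  have uw: "\<alpha>1 \<le> 1 + u / 2" "\<beta>2 \<le> 1 + w / 2" using 1 2 by (auto simp: u_def w_def)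
  have inv: "1 / (2 * t) \<le> 65/100" "1 / (2 * s) \<le> 65/100"
    using s t by (simp_all add: field_simps)
  have \<alpha>1: "0 \<le> \<alpha>1"
  proof (rule ccontr)
    assume n: "\<not> 0 \<le> \<alpha>1"
    hence "\<alpha>1 / (2 * t) < 0" using t by (simp add: divide_neg_pos)
    thus False using n 1 x by linarith
  qed
  have \<beta>2: "127/100 \<le> \<beta>2"
  proof (rule ccontr)
    assume n: "\<not> 127/100 \<le> \<beta>2"
    have "\<beta>2 * (1 / (2 * s)) \<le> 127/100 * (65/100)"
    proof (cases "0 \<le> \<beta>2")
      case True
      thus ?thesis using n s inv by (intro mult_mono) auto
    next
      case False
      hence "\<beta>2 * (1 / (2 * s)) \<le> 0" using s by (intro mult_nonpos_nonneg) auto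
      thus ?thesis by simp
    qed
    thus False using n 2 x by simp
  qed
  have u: "117/100 \<le> u"
  proof -
    have "21/10 \<le> \<beta>1 + u / 2" using uw x by linarith
    hence "t * (21/10) \<le> t * (\<beta>1 + u / 2)" using t by (intro mult_left_mono) auto
    hence a: "t * (21/10) \<le> u * (1 + t / 2)" by (simp add: u_def algebra_simps)
    have "117/100 * (1 + t / 2) \<le> t * (21/10)" using t by simp
    hence "117/100 * (1 + t / 2) \<le> u * (1 + t / 2)" using a by linarith
    thus ?thesis by (rule mult_right_le_imp_le) (use t in simp)
  qed
  show ?thesis
  proof (cases "\<beta>2 \<le> w")
    case True
    have "117/100 * (127/100) \<le> u * \<beta>2" using u \<beta>2 by (intro mult_mono) auto
    moreover have "0 \<le> \<alpha>1 * (w - \<beta>2)" using True \<alpha>1 by simp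
    ultimately show ?thesis unfolding expr by simp
  next
    case False
    \<comment> \<open>two lower bounds for \<open>w\<close>: the first decides when \<open>\<beta>2\<close> is large, the second when it is small\<close>
    have w1: "2 * \<beta>2 - 2 \<le> w" using uw by linarith
    have w2: "78/100 * (31/10 - \<beta>2) \<le> w"
    proof (cases "31/10 \<le> \<beta>2")
      case True
      thus ?thesis using w1 by simp
    next
      case False
      have "78/100 * (31/10 - \<beta>2) \<le> s * \<alpha>2" using False s x by (intro mult_mono) auto
      thus ?thesis by (simp add: w_def)
    qed
    have "(1 + u / 2) * (w - \<beta>2) \<le> \<alpha>1 * (w - \<beta>2)"
      using uw False by (intro mult_right_mono_neg) auto
    hence "(1 + u / 2) * (w - \<beta>2) + u * \<beta>2 \<le> \<alpha>1 * (w - \<beta>2) + u * \<beta>2"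
      by (rule add_right_mono)
    moreover have "(1 + u / 2) * (w - \<beta>2) + u * \<beta>2 = (w - \<beta>2) + u * ((w + \<beta>2) / 2)"
      by (simp add: field_simps)
    ultimately have "(w - \<beta>2) + u * ((w + \<beta>2) / 2) \<le> \<alpha>1 * (w - \<beta>2) + u * \<beta>2"
      by simp
    moreover have "117/100 * ((w + \<beta>2) / 2) \<le> u * ((w + \<beta>2) / 2)"
      using u w1 \<beta>2 by (intro mult_right_mono) auto
    moreover have "1 < (w - \<beta>2) + 117/100 * ((w + \<beta>2) / 2)"
      using w1 w2 by (cases "\<beta>2 \<le> 159/100") (simp_all add: field_simps)
    ultimately show ?thesis unfolding expr by (smt (verit))
  qed
qed

section \<open>Stability of balanced triangles\<close>

lemma factor_le_product:
  fixes u v w :: real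
  assumes "1 \<le> u" "1 \<le> v" "1 \<le> w"
  shows "u \<le> u * v * w" "v \<le> u * v * w" "w \<le> u * v * w"
proof -
  have "1 \<le> v * w" "1 \<le> u * w" "1 \<le> u * v"
    using assms mult_mono[of 1 v 1 w] mult_mono[of 1 u 1 w] mult_mono[of 1 u 1 v] by auto
  hence "u * 1 \<le> u * (v * w)" "v * 1 \<le> v * (u * w)" "w * 1 \<le> w * (u * v)"
    using assms by (auto intro!: mult_left_mono)
  thus "u \<le> u * v * w" "v \<le> u * v * w" "w \<le> u * v * w" by (simp_all add: mult_ac)
qed

lemma one_plus_sum_le_product:
  fixes u v w :: real
  assumes "0 \<le> u" "0 \<le> v" "0 \<le> w"
  shows "1 + (u + v + w) \<le> (1 + u) * (1 + v) * (1 + w)"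
proof -
  have "(1 + u) * (1 + v) * (1 + w) = 1 + (u + v + w) + (u * v + u * w + v * w + u * v * w)"
    by (simp add: algebra_simps)
  moreover have "0 \<le> u * v + u * w + v * w + u * v * w" using assms by simp
  ultimately show ?thesis by linarith
qed

text \<open>For a balanced triangle these points are farthest points of adjacent sectors. If all three sectors
  are high, the inequality holds for each pair of them and contradicts maximality.\<close>

lemma far_points_wedge:
  fixes a b c :: "real^2"
  assumes D: "0 < wedge b c" "0 < wedge c a" "0 < wedge a b"
    and \<rho>: "\<rho>1 = wedge c a / wedge a b" "\<rho>2 = wedge a b / wedge b c"
      "78/100 \<le> \<rho>1" "\<rho>2 \<le> 128/100"
    and x: "31/10 \<le> \<alpha>1 + \<beta>1" "31/10 \<le> \<alpha>2 + \<beta>2"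
    and 1: "\<alpha>1 - \<rho>1 * \<beta>1 / 2 \<le> 1" "\<beta>1 - \<alpha>1 / (2 * \<rho>1) \<le> 1"
    and 2: "\<alpha>2 - \<rho>2 * \<beta>2 / 2 \<le> 1" "\<beta>2 - \<alpha>2 / (2 * \<rho>2) \<le> 1"
  shows "wedge a b < wedge (\<alpha>1 *\<^sub>R b + \<beta>1 *\<^sub>R c) (\<alpha>2 *\<^sub>R c + \<beta>2 *\<^sub>R a)"
proof -
  define s where "s = wedge b c / wedge a b"
  have s: "\<rho>2 = 1 / s" "0 < s" using D by (simp_all add: s_def \<rho>)
  have "78/100 \<le> s" using \<rho>(4) s by (simp add: field_simps)
  hence "1 < s * (\<alpha>1 * \<alpha>2) - \<alpha>1 * \<beta>2 + \<rho>1 * (\<beta>1 * \<beta>2)"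
    by (rule far_points_span_more[OF _ \<rho>(3) x 1]) (use 2 s in \<open>simp_all add: mult.commute\<close>)
  hence "wedge a b * 1 < wedge a b * (s * (\<alpha>1 * \<alpha>2) - \<alpha>1 * \<beta>2 + \<rho>1 * (\<beta>1 * \<beta>2))"
    using D(3) by (intro mult_strict_left_mono)
  also have "\<dots> = wedge b c * (\<alpha>1 * \<alpha>2) - wedge a b * (\<alpha>1 * \<beta>2) + wedge c a * (\<beta>1 * \<beta>2)"
    using D(3) by (simp add: s_def \<rho>(1) field_simps)
  also have "\<dots> = wedge (\<alpha>1 *\<^sub>R b + \<beta>1 *\<^sub>R c) (\<alpha>2 *\<^sub>R c + \<beta>2 *\<^sub>R a)"
    using wedge_swap[of b a] by (simp add: wedge_algebra algebra_simps)
  finally show ?thesis by simp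
qed

text \<open>The heights \<open>x1, x2, x3\<close> describe a triangle with sides parallel to those of \<open>a, b, c\<close> that
  contains \<open>K\<close>. The dichotomy leaves, besides heights near 1, only mixed or uniformly large heights;
  the first contradict the Cauchy-Schwarz inequality, the second the maximality of the triangle.\<close>

lemma balanced_triangle_stability:
  assumes K: "compact K" "convex K" "0 \<in> interior K" and bal: "balanced_triangle K a b c"
    and \<epsilon>: "0 < \<epsilon>" "\<epsilon> < 1/300"
    and vol: "area K * area (polar K) \<le> (1 + \<epsilon>) * (27/4)"
  obtains x1 x2 x3 where "1 \<le> x1" "1 \<le> x2" "1 \<le> x3"
    "(x1 - 1) + (x2 - 1) + (x3 - 1) \<le> 16 * \<epsilon>"
    "\<And>y. y \<in> K \<Longrightarrow> wedge y (c - b) \<le> x1 * wedge b c"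
    "\<And>y. y \<in> K \<Longrightarrow> wedge y (a - c) \<le> x2 * wedge c a"
    "\<And>y. y \<in> K \<Longrightarrow> wedge y (b - a) \<le> x3 * wedge a b"
proof -
  define D1 D2 D3 where "D1 = wedge b c" and "D2 = wedge c a" and "D3 = wedge a b"
  have D: "0 < D1" "0 < D2" "0 < D3"
    using bal by (auto simp: balanced_triangle_def D1_def D2_def D3_def)
  have bal': "balanced_triangle K b c a" "balanced_triangle K c a b"
    using bal balanced_triangle_rotate by blast+
  define va vb vc where "va = dual_vertex a b c" and "vb = dual_vertex b c a"
    and "vc = dual_vertex c a b"
  define \<rho>1 \<rho>2 \<rho>3 where "\<rho>1 = D2 / D3" and "\<rho>2 = D3 / D1" and "\<rho>3 = D1 / D2"
  have \<rho>: "0 < \<rho>1" "0 < \<rho>2" "0 < \<rho>3" using D by (simp_all add: \<rho>1_def \<rho>2_def \<rho>3_def)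
  define p1 p2 p3 where "p1 = area (K \<inter> sector b c)" and "p2 = area (K \<inter> sector c a)"
    and "p3 = area (K \<inter> sector a b)"
  define q1 q2 q3 where "q1 = area (polar K \<inter> sector vb vc)"
    and "q2 = area (polar K \<inter> sector vc va)" and "q3 = area (polar K \<inter> sector va vb)"
  define s where "s \<rho> = 2 + \<rho> / 2 + 1 / (2 * \<rho>)" for \<rho> :: real
  note defs = va_def vb_def vc_def \<rho>1_def \<rho>2_def \<rho>3_def D1_def D2_def D3_def
  note S1 = balanced_sector_duality[OF K bal'(1), folded defs]
  note S2 = balanced_sector_duality[OF K bal'(2), folded defs]
  note S3 = balanced_sector_duality[OF K bal, folded defs]
  obtain \<alpha>1 \<beta>1 x1 where
    d1: "\<alpha>1 *\<^sub>R b + \<beta>1 *\<^sub>R c \<in> K" and x1: "x1 = \<alpha>1 + \<beta>1" "1 \<le> x1"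
    and h1: "\<And>y. y \<in> K \<Longrightarrow> wedge y (c - b) \<le> x1 * D1"
    and P1: "x1 * D1 \<le> 2 * p1" and Q1: "s \<rho>1 \<le> 2 * q1 * (x1 * D1)"
    and b1: "\<alpha>1 - \<rho>1 * \<beta>1 / 2 \<le> 1" "\<beta>1 - \<alpha>1 / (2 * \<rho>1) \<le> 1"
    and g1: "\<And>\<gamma>. \<lbrakk>78/100 \<le> \<rho>1; \<rho>1 \<le> 128/100; 0 \<le> \<gamma>;
      2 * x1 * s \<rho>1 * (\<gamma> * (1 + \<gamma>)) \<le> (x1 - 1) * (2 - 61/100 * x1)\<rbrakk>
      \<Longrightarrow> s \<rho>1 * (1 + \<gamma>) \<le> 4 * p1 * q1"
    unfolding s_def p1_def q1_def D1_def
    using sector_farthest_point[OF S1(1) \<rho>(1) S1(2,3)] by blast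
  obtain \<alpha>2 \<beta>2 x2 where
    d2: "\<alpha>2 *\<^sub>R c + \<beta>2 *\<^sub>R a \<in> K" and x2: "x2 = \<alpha>2 + \<beta>2" "1 \<le> x2"
    and h2: "\<And>y. y \<in> K \<Longrightarrow> wedge y (a - c) \<le> x2 * D2"
    and P2: "x2 * D2 \<le> 2 * p2" and Q2: "s \<rho>2 \<le> 2 * q2 * (x2 * D2)"
    and b2: "\<alpha>2 - \<rho>2 * \<beta>2 / 2 \<le> 1" "\<beta>2 - \<alpha>2 / (2 * \<rho>2) \<le> 1"
    and g2: "\<And>\<gamma>. \<lbrakk>78/100 \<le> \<rho>2; \<rho>2 \<le> 128/100; 0 \<le> \<gamma>;
      2 * x2 * s \<rho>2 * (\<gamma> * (1 + \<gamma>)) \<le> (x2 - 1) * (2 - 61/100 * x2)\<rbrakk>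
      \<Longrightarrow> s \<rho>2 * (1 + \<gamma>) \<le> 4 * p2 * q2"
    unfolding s_def p2_def q2_def D2_def
    using sector_farthest_point[OF S2(1) \<rho>(2) S2(2,3)] by blast
  obtain \<alpha>3 \<beta>3 x3 where
    d3: "\<alpha>3 *\<^sub>R a + \<beta>3 *\<^sub>R b \<in> K" and x3: "x3 = \<alpha>3 + \<beta>3" "1 \<le> x3"
    and h3: "\<And>y. y \<in> K \<Longrightarrow> wedge y (b - a) \<le> x3 * D3"
    and P3: "x3 * D3 \<le> 2 * p3" and Q3: "s \<rho>3 \<le> 2 * q3 * (x3 * D3)"
    and b3: "\<alpha>3 - \<rho>3 * \<beta>3 / 2 \<le> 1" "\<beta>3 - \<alpha>3 / (2 * \<rho>3) \<le> 1"
    and g3: "\<And>\<gamma>. \<lbrakk>78/100 \<le> \<rho>3; \<rho>3 \<le> 128/100; 0 \<le> \<gamma>;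
      2 * x3 * s \<rho>3 * (\<gamma> * (1 + \<gamma>)) \<le> (x3 - 1) * (2 - 61/100 * x3)\<rbrakk>
      \<Longrightarrow> s \<rho>3 * (1 + \<gamma>) \<le> 4 * p3 * q3"
    unfolding s_def p3_def q3_def D3_def
    using sector_farthest_point[OF S3(1) \<rho>(3) S3(2,3)] by blast
  have nonneg: "0 \<le> p1" "0 \<le> p2" "0 \<le> p3" "0 \<le> q1" "0 \<le> q2" "0 \<le> q3"
    by (simp_all add: p1_def p2_def p3_def q1_def q2_def q3_def)
  define g where "g p q = 4 * p * q" for p q :: real
  have sums: "(p1 + p2 + p3) * (q1 + q2 + q3) \<le> (1 + \<epsilon>) * (27/4)"
  proof -
    have "p1 + p2 + p3 \<le> area K"
      using sector_area_three[OF K(1), of b c a] by (simp add: p1_def p2_def p3_def)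
    moreover have "q1 + q2 + q3 \<le> area (polar K)"
      using sector_area_three[OF compact_polar[OF K(3)], of vb vc va]
      by (simp add: q1_def q2_def q3_def)
    ultimately have "(p1 + p2 + p3) * (q1 + q2 + q3) \<le> area K * area (polar K)"
      using nonneg by (intro mult_mono) auto
    thus ?thesis using vol by linarith
  qed
  \<comment> \<open>all three factors are at least 1, so this bounds each of them\<close>
  have prod: "(g p1 q1 / 3) * (g p2 q2 / 3) * (g p3 q3 / 3) \<le> (1 + \<epsilon>)^3"
  proof -
    have "27 * 27 * ((p1 * q1) * (p2 * q2) * (p3 * q3)) \<le> ((1 + \<epsilon>) * (27/4))^3"
      using product_of_sums_ge[OF nonneg] power_mono[OF sums, of 3] nonneg by simp
    also have "\<dots> = (1 + \<epsilon>)^3 * (27/4)^3" by (rule power_mult_distrib)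
    finally have "64/27 * ((p1 * q1) * (p2 * q2) * (p3 * q3)) \<le> (1 + \<epsilon>)^3"
      by (simp add: power_divide mult_ac)
    moreover have "(g p1 q1 / 3) * (g p2 q2 / 3) * (g p3 q3 / 3)
        = 64/27 * ((p1 * q1) * (p2 * q2) * (p3 * q3))"
      by (simp add: g_def)
    ultimately show ?thesis by (simp only:)
  qed
  have s3: "3 \<le> s \<rho>1" "3 \<le> s \<rho>2" "3 \<le> s \<rho>3"
    using sum_reciprocal_ge_2[OF \<rho>(1)] sum_reciprocal_ge_2[OF \<rho>(2)] sum_reciprocal_ge_2[OF \<rho>(3)]
    unfolding s_def by linarith+
  have sg: "s \<rho>1 \<le> g p1 q1" "s \<rho>2 \<le> g p2 q2" "s \<rho>3 \<le> g p3 q3"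
    using Q1 mult_left_mono[OF P1, of "2 * q1"] Q2 mult_left_mono[OF P2, of "2 * q2"]
      Q3 mult_left_mono[OF P3, of "2 * q3"] nonneg by (simp_all add: g_def mult_ac)
  have ge1: "1 \<le> g p1 q1 / 3" "1 \<le> g p2 q2 / 3" "1 \<le> g p3 q3 / 3" using s3 sg by auto
  have cube: "(1 + \<epsilon>)^3 \<le> 1 + 302/100 * \<epsilon>"
  proof -
    have "\<epsilon> * \<epsilon> \<le> \<epsilon> * (1/300)" "\<epsilon> * \<epsilon> * \<epsilon> \<le> \<epsilon> * (1/300) * (1/300)"
      using \<epsilon> by (intro mult_mono; simp)+
    moreover have "(1 + \<epsilon>)^3 = 1 + 3 * \<epsilon> + 3 * (\<epsilon> * \<epsilon>) + \<epsilon> * \<epsilon> * \<epsilon>"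
      by (simp add: power3_eq_cube algebra_simps)
    ultimately show ?thesis using \<epsilon>(1) by argo
  qed
  hence gb: "g p1 q1 \<le> 30302/10000" "g p2 q2 \<le> 30302/10000" "g p3 q3 \<le> 30302/10000"
    using factor_le_product[OF ge1] prod \<epsilon> by (simp_all add: field_simps)
  have bnd: "\<rho> / 2 + 1 / (2 * \<rho>) \<le> 10302/10000" if "s \<rho> \<le> h" "h \<le> 30302/10000" for \<rho> h
  proof -
    have "2 + (\<rho> / 2 + 1 / (2 * \<rho>)) \<le> 30302/10000"
      using order_trans[OF that] by (simp only: s_def add.assoc)
    thus ?thesis by simp
  qed
  have sb: "\<rho>1 / 2 + 1 / (2 * \<rho>1) \<le> 10302/10000" "\<rho>2 / 2 + 1 / (2 * \<rho>2) \<le> 10302/10000"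
    "\<rho>3 / 2 + 1 / (2 * \<rho>3) \<le> 10302/10000"
    by (rule bnd[OF sg(1) gb(1)], rule bnd[OF sg(2) gb(2)], rule bnd[OF sg(3) gb(3)])
  note r1 = near_one_if_sum_reciprocal_small[OF \<rho>(1) sb(1)]
  note r2 = near_one_if_sum_reciprocal_small[OF \<rho>(2) sb(2)]
  note r3 = near_one_if_sum_reciprocal_small[OF \<rho>(3) sb(3)]
  have dich1: "x1 \<le> 105/100 \<or> 31/10 \<le> x1"
    "x1 \<le> 105/100 \<Longrightarrow> 1 + (x1 - 1) / 5 \<le> g p1 q1 / 3"
    using height_dichotomy[OF x1(2) s3(1) sg(1) gb(1)] g1[OF r1, folded g_def] by blast+
  have dich2: "x2 \<le> 105/100 \<or> 31/10 \<le> x2"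
    "x2 \<le> 105/100 \<Longrightarrow> 1 + (x2 - 1) / 5 \<le> g p2 q2 / 3"
    using height_dichotomy[OF x2(2) s3(2) sg(2) gb(2)] g2[OF r2, folded g_def] by blast+
  have dich3: "x3 \<le> 105/100 \<or> 31/10 \<le> x3"
    "x3 \<le> 105/100 \<Longrightarrow> 1 + (x3 - 1) / 5 \<le> g p3 q3 / 3"
    using height_dichotomy[OF x3(2) s3(3) sg(3) gb(3)] g3[OF r3, folded g_def] by blast+
  define z1 z2 z3 where "z1 = x1 * D1" and "z2 = x2 * D2" and "z3 = x3 * D3"
  have z: "0 < z1" "0 < z2" "0 < z3" using x1 x2 x3 D by (simp_all add: z1_def z2_def z3_def)
  have zsum: "(z1 + z2 + z3) * (1/z1 + 1/z2 + 1/z3) < 19/2"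
  proof -
    have "3 * (1/z1) \<le> 2 * q1" "3 * (1/z2) \<le> 2 * q2" "3 * (1/z3) \<le> 2 * q3"
      using Q1 Q2 Q3 s3 z unfolding z1_def[symmetric] z2_def[symmetric] z3_def[symmetric]
      by (auto simp: field_simps)
    hence zq: "3 * (1/z1 + 1/z2 + 1/z3) \<le> 2 * (q1 + q2 + q3)" by argo
    have zp: "z1 + z2 + z3 \<le> 2 * (p1 + p2 + p3)"
      using P1 P2 P3 by (simp add: z1_def z2_def z3_def)
    have "(z1 + z2 + z3) * (3 * (1/z1 + 1/z2 + 1/z3))
        \<le> (2 * (p1 + p2 + p3)) * (2 * (q1 + q2 + q3))"
      by (rule mult_mono[OF zp zq]) (use nonneg z in auto)
    also have "\<dots> = 4 * ((p1 + p2 + p3) * (q1 + q2 + q3))"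
      by algebra
    also have "\<dots> \<le> 4 * ((1 + \<epsilon>) * (27/4))" using sums by simp
    also have "\<dots> < 3 * (19/2)" using \<epsilon> by simp
    finally have fin: "(z1 + z2 + z3) * (3 * (1/z1 + 1/z2 + 1/z3)) < 3 * (19/2)" .
    have "u * v < 19/2" if "u * (3 * v) < 3 * (19/2)" for u v :: real using that by simp
    from this[OF fin] show ?thesis .
  qed
  have zr: "z1 < 2 * z2" "z2 < 2 * z1" "z2 < 2 * z3" "z3 < 2 * z2" "z1 < 2 * z3" "z3 < 2 * z1"
    using zsum z by (auto intro!: reciprocal_weights_ratio[of z1 z2 z3]
        reciprocal_weights_ratio[of z2 z1 z3] reciprocal_weights_ratio[of z2 z3 z1]
        reciprocal_weights_ratio[of z3 z2 z1] reciprocal_weights_ratio[of z1 z3 z2]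
        reciprocal_weights_ratio[of z3 z1 z2] simp: add_ac)
  have Dr: "78/100 * D3 \<le> D2" "78/100 * D2 \<le> D3" "78/100 * D1 \<le> D3" "78/100 * D3 \<le> D1"
    "78/100 * D2 \<le> D1" "78/100 * D1 \<le> D2"
    using r1 r2 r3 D by (auto simp: \<rho>1_def \<rho>2_def \<rho>3_def field_simps)
  \<comment> \<open>a high sector next to a low one contradicts \<open>zr\<close>, as the three determinants are comparable\<close>
  have no_mix: False
    if "31/10 \<le> x" "y \<le> 105/100" "78/100 * E \<le> F" "0 < E" "x * F < 2 * (y * E)"
    for x y E F :: real
  proof -
    have "31/10 * (78/100 * E) \<le> x * F" using that by (intro mult_mono) auto
    moreover have "y * E \<le> 105/100 * E" using that by (intro mult_right_mono) auto
    ultimately show False using that by simp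
  qed
  have "\<not> (31/10 \<le> x1 \<and> 31/10 \<le> x2 \<and> 31/10 \<le> x3)"
  proof
    assume far: "31/10 \<le> x1 \<and> 31/10 \<le> x2 \<and> 31/10 \<le> x3"
    define e1 e2 e3 where "e1 = \<alpha>1 *\<^sub>R b + \<beta>1 *\<^sub>R c" and "e2 = \<alpha>2 *\<^sub>R c + \<beta>2 *\<^sub>R a"
      and "e3 = \<alpha>3 *\<^sub>R a + \<beta>3 *\<^sub>R b"
    have far': "31/10 \<le> \<alpha>1 + \<beta>1" "31/10 \<le> \<alpha>2 + \<beta>2" "31/10 \<le> \<alpha>3 + \<beta>3"
      using far x1 x2 x3 by auto
    note D' = D[unfolded D1_def D2_def D3_def]
    note \<rho>' = \<rho>1_def[unfolded D1_def D2_def D3_def] \<rho>2_def[unfolded D1_def D2_def D3_def]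
      \<rho>3_def[unfolded D1_def D2_def D3_def]
    have w: "D3 < wedge e1 e2" "D1 < wedge e2 e3" "D2 < wedge e3 e1"
      unfolding D1_def D2_def D3_def e1_def e2_def e3_def
      using far_points_wedge[OF D' \<rho>'(1,2) r1(1) r2(2) far'(1,2) b1 b2]
        far_points_wedge[OF D'(2,3,1) \<rho>'(2,3) r2(1) r3(2) far'(2,3) b2 b3]
        far_points_wedge[OF D'(3,1,2) \<rho>'(3,1) r3(1) r1(2) far'(3,1) b3 b1]
      by auto
    have "wedge e2 e3 * wedge e3 e1 * wedge e1 e2 \<le> D1 * D2 * D3"
      using bal d1 d2 d3 w D
      unfolding balanced_triangle_def D1_def[symmetric] D2_def[symmetric] D3_def[symmetric]
        e1_def[symmetric] e2_def[symmetric] e3_def[symmetric]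
      by (meson order.strict_trans)
    moreover have "D1 * D2 * D3 < wedge e2 e3 * wedge e3 e1 * wedge e1 e2"
      using w D by (intro mult_strict_mono) auto
    ultimately show False by simp
  qed
  hence near: "x1 \<le> 105/100" "x2 \<le> 105/100" "x3 \<le> 105/100"
    using dich1(1) dich2(1) dich3(1) D Dr zr no_mix unfolding z1_def z2_def z3_def by metis+
  have "1 + ((x1 - 1) / 5 + (x2 - 1) / 5 + (x3 - 1) / 5)
      \<le> (1 + (x1 - 1) / 5) * (1 + (x2 - 1) / 5) * (1 + (x3 - 1) / 5)"
    using x1 x2 x3 by (intro one_plus_sum_le_product) auto
  also have "\<dots> \<le> (g p1 q1 / 3) * (g p2 q2 / 3) * (g p3 q3 / 3)"
    using dich1(2)[OF near(1)] dich2(2)[OF near(2)] dich3(2)[OF near(3)] x1 x2 x3 ge1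
    by (intro mult_mono) auto
  also have "\<dots> \<le> 1 + 302/100 * \<epsilon>" using prod cube by linarith
  finally have "(x1 - 1) + (x2 - 1) + (x3 - 1) \<le> 16 * \<epsilon>" using \<epsilon> by argo
  thus ?thesis
    by (rule that[OF x1(2) x2(2) x3(2) _ h1[unfolded D1_def] h2[unfolded D2_def] h3[unfolded D3_def]])
qed

section \<open>The Banach-Mazur distance from triangles\<close>

lemma collinear_iff_wedge:
  "collinear {a, b, c} \<longleftrightarrow> wedge (b - a) (c - a) = 0"
proof -
  have "collinear {a, b, c} \<longleftrightarrow> collinear {0, b - a, c - a}"
    using collinear_3[of b a c] by (simp add: insert_commute)
  also have "\<dots> \<longleftrightarrow> wedge (b - a) (c - a) = 0"
  proof
    assume "collinear {0, b - a, c - a}"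
    thus "wedge (b - a) (c - a) = 0"
      unfolding collinear_lemma by (auto simp: wedge_algebra(6))
  next
    define u v where "u = b - a" and "v = c - a"
    assume "wedge (b - a) (c - a) = 0"
    hence w: "u$1 * v$2 = u$2 * v$1" by (simp add: wedge_def u_def v_def)
    have "(u \<bullet> u) *\<^sub>R v = (u \<bullet> v) *\<^sub>R u"
      using w by (auto simp: vec_eq_iff forall_2 inner_2 algebra_simps)
    hence "v = ((u \<bullet> v) / (u \<bullet> u)) *\<^sub>R u" if "u \<noteq> 0"
    proof -
      have "v = (1 / (u \<bullet> u)) *\<^sub>R ((u \<bullet> u) *\<^sub>R v)" using that by simp
      also have "\<dots> = ((u \<bullet> v) / (u \<bullet> u)) *\<^sub>R u"
        unfolding \<open>(u \<bullet> u) *\<^sub>R v = (u \<bullet> v) *\<^sub>R u\<close> by simp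
      finally show ?thesis .
    qed
    thus "collinear {0, b - a, c - a}"
      unfolding collinear_lemma u_def v_def by blast
  qed
  finally show ?thesis .
qed

definition plane_map :: "real^2 \<Rightarrow> real^2 \<Rightarrow> real^2 \<Rightarrow> real^2" where
  "plane_map p q v = v$1 *\<^sub>R p + v$2 *\<^sub>R q"

lemma linear_plane_map: "linear (plane_map p q)"
  by (rule linearI) (simp_all add: plane_map_def algebra_simps)

text \<open>A linear map of the plane multiplies \<open>wedge\<close> by a constant, so one nonzero value excludes a
  kernel.\<close>

lemma bij_linear_if_wedge:
  fixes f :: "real^2 \<Rightarrow> real^2"
  assumes "linear f" and w: "wedge (f u) (f v) \<noteq> 0"
  shows "bij f"
proof -
  have "inj f"
  proof (subst linear_injective_0[OF assms(1)], intro allI impI)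
    fix x assume x: "f x = 0"
    have "wedge u v \<noteq> 0"
    proof
      assume "wedge u v = 0"
      hence "collinear {0, u, v}" using collinear_iff_wedge[of 0 u v] by simp
      hence "wedge (f u) (f v) = 0"
        unfolding collinear_lemma
        by (auto simp: linear_0[OF assms(1)] linear_scale[OF assms(1)] wedge_algebra(6))
      thus False using w by simp
    qed
    define s t where "s = wedge x v / wedge u v" and "t = wedge u x / wedge u v"
    have xr: "x = s *\<^sub>R u + t *\<^sub>R v"
      unfolding s_def t_def by (rule wedge_coordinates[OF \<open>wedge u v \<noteq> 0\<close>])
    have fx: "s *\<^sub>R f u + t *\<^sub>R f v = 0"
      using x unfolding xr by (simp add: linear_add[OF assms(1)] linear_scale[OF assms(1)])
    have "s * wedge (f u) (f v) = wedge (s *\<^sub>R f u + t *\<^sub>R f v) (f v)"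
      "t * wedge (f u) (f v) = wedge (f u) (s *\<^sub>R f u + t *\<^sub>R f v)"
      by (simp_all add: wedge_algebra)
    hence "s = 0" "t = 0" using w unfolding fx by simp_all
    thus "x = 0" using xr by simp
  qed
  thus ?thesis using linear_injective_imp_surjective[OF assms(1)] by (simp add: bij_def)
qed

text \<open>The ratios whose minimum is the Banach-Mazur distance.\<close>

definition bm_ratio :: "(real^2) set \<Rightarrow> (real^2) set \<Rightarrow> real \<Rightarrow> bool" where
  "bm_ratio K L d \<longleftrightarrow> (\<exists>l1 l2 A x. d = l2 / l1 \<and> 0 < l1 \<and> 0 < l2 \<and> affinity A \<and>
        homothet l1 (A ` K) 0 \<subseteq> L \<and> L \<subseteq> homothet l2 (A ` K) x)"

lemma convex_homothet:
  assumes "convex S"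
  shows "convex (homothet l S x)"
proof -
  have "homothet l S x = (\<lambda>v. x + v) ` ((\<lambda>v. l *\<^sub>R v) ` S)"
    by (auto simp: homothet_def image_image add.commute)
  thus ?thesis using assms by (simp add: convex_translation convex_scaling)
qed

lemma convex_affinity_image:
  assumes "affinity A" "convex S"
  shows "convex (A ` S)"
proof -
  obtain f b where f: "linear f" "A = (\<lambda>v. f v + b)"
    using assms(1) unfolding affinity_def by blast
  have "A ` S = (\<lambda>v. b + v) ` (f ` S)" by (auto simp: f image_image add.commute)
  thus ?thesis using convex_linear_image[OF f(1) assms(2)] by (simp add: convex_translation)
qed

text \<open>Rescaling makes the smaller factor 1. An affine map sending \<open>K\<close> into \<open>T\<close> is determined by its
  values at three fixed points of \<open>K\<close>, and these values lie in \<open>T\<close>. That \<open>T\<close> is contained in the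
  enlarged image is witnessed by preimages in \<open>K\<close> of the three vertices, and taking differences of
  vertices eliminates the translation. So the admissible data form a compact set. None of its elements
  is degenerate, because the vertices of \<open>T\<close> are not collinear.\<close>

lemma bm_ratio_minimum:
  assumes K: "convex_body K" and T: "triangle T" and d0: "bm_ratio K T d0"
  obtains m where "bm_ratio K T m" "\<And>d. bm_ratio K T d \<Longrightarrow> m \<le> d"
proof -
  obtain t1 t2 t3 where nc: "\<not> collinear {t1, t2, t3}" and T': "T = convex hull {t1, t2, t3}"
    using T unfolding triangle_def by blast
  have compT: "compact T" by (simp add: T' compact_convex_hull finite_imp_compact)
  have tT: "t1 \<in> T" "t2 \<in> T" "t3 \<in> T" by (simp_all add: T' hull_inc)
  have compK: "compact K" "convex K" and intK: "interior K \<noteq> {}"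
    using K by (auto simp: convex_body_def)
  obtain z r where r: "0 < r" "cball z r \<subseteq> K"
    using intK mem_interior_cball by (metis ex_in_conv)
  define z1 z2 where "z1 = z + r *\<^sub>R axis 1 1" and "z2 = z + r *\<^sub>R axis 2 (1::real)"
  have zK: "z \<in> K" "z1 \<in> K" "z2 \<in> K"
    using r by (auto intro!: subsetD[OF r(2)] simp: z1_def z2_def dist_norm)
  define G where "G u u1 u2 v = u + ((v$1 - z$1) / r) *\<^sub>R (u1 - u) + ((v$2 - z$2) / r) *\<^sub>R (u2 - u)"
    for u u1 u2 v :: "real^2"
  define C where "C = {w \<in> T \<times> T \<times> T \<times> {0..d0} \<times> K \<times> K \<times> K.
      (\<forall>v\<in>K. G (fst w) (fst (snd w)) (fst (snd (snd w))) v \<in> T) \<and>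
      t2 - t1 = fst (snd (snd (snd w))) *\<^sub>R
        (G (fst w) (fst (snd w)) (fst (snd (snd w))) (fst (snd (snd (snd (snd (snd w))))))
         - G (fst w) (fst (snd w)) (fst (snd (snd w))) (fst (snd (snd (snd (snd w)))))) \<and>
      t3 - t1 = fst (snd (snd (snd w))) *\<^sub>R
        (G (fst w) (fst (snd w)) (fst (snd (snd w))) (snd (snd (snd (snd (snd (snd w))))))
         - G (fst w) (fst (snd w)) (fst (snd (snd w))) (fst (snd (snd (snd (snd w))))))}"
  have memC: "(u, u1, u2, d, v1, v2, v3) \<in> C \<longleftrightarrow>
      u \<in> T \<and> u1 \<in> T \<and> u2 \<in> T \<and> 0 \<le> d \<and> d \<le> d0 \<and> v1 \<in> K \<and> v2 \<in> K \<and> v3 \<in> K \<and>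
      (\<forall>v\<in>K. G u u1 u2 v \<in> T) \<and> t2 - t1 = d *\<^sub>R (G u u1 u2 v2 - G u u1 u2 v1) \<and>
      t3 - t1 = d *\<^sub>R (G u u1 u2 v3 - G u u1 u2 v1)" for u u1 u2 d v1 v2 v3
    unfolding C_def by auto
  have "compact C"
  proof -
    let ?X = "T \<times> T \<times> T \<times> {0..d0} \<times> K \<times> K \<times> K"
    let ?A = "\<Inter>v\<in>K. {w::(real^2)\<times>(real^2)\<times>(real^2)\<times>real\<times>(real^2)\<times>(real^2)\<times>(real^2).
      G (fst w) (fst (snd w)) (fst (snd (snd w))) v \<in> T}"
    let ?B = "{w::(real^2)\<times>(real^2)\<times>(real^2)\<times>real\<times>(real^2)\<times>(real^2)\<times>(real^2).
      t2 - t1 = fst (snd (snd (snd w))) *\<^sub>R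
        (G (fst w) (fst (snd w)) (fst (snd (snd w))) (fst (snd (snd (snd (snd (snd w))))))
         - G (fst w) (fst (snd w)) (fst (snd (snd w))) (fst (snd (snd (snd (snd w))))))}"
    let ?D = "{w::(real^2)\<times>(real^2)\<times>(real^2)\<times>real\<times>(real^2)\<times>(real^2)\<times>(real^2).
      t3 - t1 = fst (snd (snd (snd w))) *\<^sub>R
        (G (fst w) (fst (snd w)) (fst (snd (snd w))) (snd (snd (snd (snd (snd (snd w))))))
         - G (fst w) (fst (snd w)) (fst (snd (snd w))) (fst (snd (snd (snd (snd w))))))}"
    have "closed {w::(real^2)\<times>(real^2)\<times>(real^2)\<times>real\<times>(real^2)\<times>(real^2)\<times>(real^2).
        G (fst w) (fst (snd w)) (fst (snd (snd w))) v \<in> T}" for v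
    proof -
      have "continuous_on UNIV (\<lambda>w::(real^2)\<times>(real^2)\<times>(real^2)\<times>real\<times>(real^2)\<times>(real^2)\<times>(real^2).
          G (fst w) (fst (snd w)) (fst (snd (snd w))) v)"
        unfolding G_def by (intro continuous_intros)
      hence "closed ((\<lambda>w::(real^2)\<times>(real^2)\<times>(real^2)\<times>real\<times>(real^2)\<times>(real^2)\<times>(real^2).
          G (fst w) (fst (snd w)) (fst (snd (snd w))) v) -` T)"
        using compact_imp_closed[OF compT] by (simp add: continuous_on_closed_vimage)
      thus ?thesis by (simp add: vimage_def)
    qed
    hence "closed ?A" by blast
    moreover have "closed ?B" unfolding G_def using r(1)
      by (intro closed_Collect_eq continuous_intros) auto
    moreover have "closed ?D" unfolding G_def using r(1)
      by (intro closed_Collect_eq continuous_intros) auto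
    moreover have "compact ?X" by (intro compact_Times compT compK compact_Icc)
    moreover have "C = ?X \<inter> (?A \<inter> ?B \<inter> ?D)" unfolding C_def by auto
    ultimately show ?thesis by (simp only: compact_Int_closed closed_Int)
  qed
  have toC: "\<exists>u u1 u2 v1 v2 v3. (u, u1, u2, d, v1, v2, v3) \<in> C"
    if bd: "bm_ratio K T d" "d \<le> d0" for d
  proof -
    obtain l1 l2 A x where l: "d = l2 / l1" "0 < l1" "0 < l2" "affinity A"
      "homothet l1 (A ` K) 0 \<subseteq> T" "T \<subseteq> homothet l2 (A ` K) x"
      using bd(1) unfolding bm_ratio_def by blast
    obtain f b where f: "linear f" "A = (\<lambda>v. f v + b)"
      using l(4) unfolding affinity_def by blast
    have AT: "l1 *\<^sub>R A v \<in> T" if "v \<in> K" for v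
      using l(5) that by (auto simp: homothet_def)
    have G: "G (l1 *\<^sub>R A z) (l1 *\<^sub>R A z1) (l1 *\<^sub>R A z2) v = l1 *\<^sub>R A v" for v
    proof -
      have "v - z = (v$1 - z$1) *\<^sub>R axis 1 1 + (v$2 - z$2) *\<^sub>R axis 2 1"
        by (simp add: vec_eq_iff forall_2 axis_def)
      hence "f v - f z = (v$1 - z$1) *\<^sub>R f (axis 1 1) + (v$2 - z$2) *\<^sub>R f (axis 2 1)"
        by (metis linear_diff[OF f(1)] linear_add[OF f(1)] linear_scale[OF f(1)])
      hence fv: "f v = f z + (v$1 - z$1) *\<^sub>R f (axis 1 1) + (v$2 - z$2) *\<^sub>R f (axis 2 1)"
        by (simp add: algebra_simps)
      have "A z1 = A z + r *\<^sub>R f (axis 1 1)" "A z2 = A z + r *\<^sub>R f (axis 2 1)"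
        by (simp_all add: f z1_def z2_def linear_add[OF f(1)] linear_scale[OF f(1)])
      hence "l1 *\<^sub>R A z1 - l1 *\<^sub>R A z = (l1 * r) *\<^sub>R f (axis 1 1)"
        "l1 *\<^sub>R A z2 - l1 *\<^sub>R A z = (l1 * r) *\<^sub>R f (axis 2 1)"
        by (simp_all add: scaleR_add_right)
      hence "G (l1 *\<^sub>R A z) (l1 *\<^sub>R A z1) (l1 *\<^sub>R A z2) v = l1 *\<^sub>R A z
          + (l1 * (v$1 - z$1)) *\<^sub>R f (axis 1 1) + (l1 * (v$2 - z$2)) *\<^sub>R f (axis 2 1)"
        using r(1) by (simp add: G_def mult.commute)
      also have "\<dots> = l1 *\<^sub>R A v"
        by (simp add: f(2) fv scaleR_add_right)
      finally show ?thesis .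
    qed
    have "\<exists>v\<in>K. t = l2 *\<^sub>R A v + x" if "t \<in> T" for t
      using l(6) that by (auto simp: homothet_def)
    then obtain v1 v2 v3 where v: "v1 \<in> K" "v2 \<in> K" "v3 \<in> K"
      "t1 = l2 *\<^sub>R A v1 + x" "t2 = l2 *\<^sub>R A v2 + x" "t3 = l2 *\<^sub>R A v3 + x"
      using tT by metis
    have "(l1 *\<^sub>R A z, l1 *\<^sub>R A z1, l1 *\<^sub>R A z2, d, v1, v2, v3) \<in> C"
      unfolding memC G using AT zK v l bd(2)
      by (auto simp: scaleR_diff_right)
    thus ?thesis by blast
  qed
  have fromC: "bm_ratio K T d" if w: "(u, u1, u2, d, v1, v2, v3) \<in> C" for u u1 u2 d v1 v2 v3
  proof -
    note m = w[unfolded memC]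
    define f where "f = plane_map ((1/r) *\<^sub>R (u1 - u)) ((1/r) *\<^sub>R (u2 - u))"
    define A where "A v = f v + (u - f z)" for v
    have lf: "linear f" unfolding f_def by (rule linear_plane_map)
    have GA: "G u u1 u2 v = A v" for v
      by (simp add: G_def A_def f_def plane_map_def algebra_simps diff_divide_distrib)
    have t: "t2 - t1 = d *\<^sub>R f (v2 - v1)" "t3 - t1 = d *\<^sub>R f (v3 - v1)"
      using m unfolding GA by (simp_all add: A_def linear_diff[OF lf])
    have "wedge (t2 - t1) (t3 - t1) \<noteq> 0" using nc collinear_iff_wedge by blast
    hence ne: "d \<noteq> 0" "wedge (f (v2 - v1)) (f (v3 - v1)) \<noteq> 0"
      unfolding t by (auto simp: wedge_algebra)
    have aff: "affinity A"
      unfolding affinity_def A_def using lf bij_linear_if_wedge[OF lf ne(2)] by blast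
    define x where "x = t1 - d *\<^sub>R A v1"
    have tx: "t1 = d *\<^sub>R A v1 + x" "t2 = d *\<^sub>R A v2 + x" "t3 = d *\<^sub>R A v3 + x"
      using m unfolding GA by (auto simp: x_def algebra_simps)
    have "{t1, t2, t3} \<subseteq> homothet d (A ` K) x"
      using m tx by (auto simp: homothet_def)
    hence "T \<subseteq> homothet d (A ` K) x"
      unfolding T' by (intro hull_minimal convex_homothet convex_affinity_image aff compK)
    moreover have "homothet 1 (A ` K) 0 \<subseteq> T" using m GA by (auto simp: homothet_def)
    moreover have "0 < d" using m ne by simp
    ultimately show ?thesis
      unfolding bm_ratio_def using aff
      by (intro exI[of _ 1] exI[of _ d] exI[of _ A] exI[of _ x]) auto
  qed
  obtain w0 where "w0 \<in> C" using toC[OF d0 order_refl] by blast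
  have "continuous_on C (\<lambda>w. fst (snd (snd (snd w))))" by (intro continuous_intros)
  then obtain w where w: "w \<in> C"
    "\<And>v. v \<in> C \<Longrightarrow> fst (snd (snd (snd w))) \<le> fst (snd (snd (snd v)))"
    using continuous_attains_inf[OF \<open>compact C\<close>] \<open>w0 \<in> C\<close> by (metis empty_iff)
  obtain u u1 u2 m v1 v2 v3 where wt: "w = (u, u1, u2, m, v1, v2, v3)" by (metis surj_pair)
  show ?thesis
  proof (rule that)
    show "bm_ratio K T m" using fromC w(1) wt by blast
    show "m \<le> d" if "bm_ratio K T d" for d
    proof (cases "d \<le> d0")
      case True
      thus ?thesis using toC[OF that True] w(2) wt by fastforce
    next
      case False
      have "m \<le> d0" using w(1) unfolding wt memC by simp
      thus ?thesis using False by simp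
    qed
  qed
qed

text \<open>All triangles are affinely equivalent; it is therefore enough to exhibit a single pair of homothetic
  triangles enclosing \<open>K\<close>.\<close>

lemma banach_mazur_le:
  assumes K: "convex_body K" and T: "triangle T" and nc: "\<not> collinear {a, b, c}"
    and \<rho>: "0 < \<rho>" and sub: "convex hull {a, b, c} \<subseteq> K"
    and sup: "K \<subseteq> homothet \<rho> (convex hull {a, b, c}) y"
  shows "banach_mazur_distance K T \<le> \<rho>"
proof -
  obtain t1 t2 t3 where nt: "\<not> collinear {t1, t2, t3}" and T': "T = convex hull {t1, t2, t3}"
    using T unfolding triangle_def by blast
  define D where "D = wedge (b - a) (c - a)"
  have D: "D \<noteq> 0" using nc by (simp add: D_def collinear_iff_wedge)
  define f where "f v = (wedge v (c - a) / (\<rho> * D)) *\<^sub>R (t2 - t1)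
      + (wedge (b - a) v / (\<rho> * D)) *\<^sub>R (t3 - t1)" for v
  have lf: "linear f"
    by (rule linearI) (simp_all add: f_def wedge_algebra(1,2,5,6) add_divide_distrib
        scaleR_add_left scaleR_add_right)
  have fb: "f (b - a) = (1 / \<rho>) *\<^sub>R (t2 - t1)" "f (c - a) = (1 / \<rho>) *\<^sub>R (t3 - t1)"
    using D by (simp_all add: f_def D_def[symmetric])
  have "wedge (f (b - a)) (f (c - a)) \<noteq> 0"
    unfolding fb using nt \<rho> by (simp add: wedge_algebra(5,6) collinear_iff_wedge)
  hence bf: "bij f" by (rule bij_linear_if_wedge[OF lf])
  define k where "k = t1 - f (\<rho> *\<^sub>R a + y)"
  define A where "A v = f v + k" for v
  have aff: "affinity A" unfolding affinity_def A_def using lf bf by blast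
  have At: "A (\<rho> *\<^sub>R (\<alpha> *\<^sub>R a + \<beta> *\<^sub>R b + \<gamma> *\<^sub>R c) + y) = \<alpha> *\<^sub>R t1 + \<beta> *\<^sub>R t2 + \<gamma> *\<^sub>R t3"
    if "\<alpha> + \<beta> + \<gamma> = 1" for \<alpha> \<beta> \<gamma>
  proof -
    have \<alpha>: "\<alpha> = 1 - \<beta> - \<gamma>" using that by simp
    have "\<rho> *\<^sub>R (\<alpha> *\<^sub>R a + \<beta> *\<^sub>R b + \<gamma> *\<^sub>R c) + y
        = (\<rho> *\<^sub>R a + y) + (\<rho> * \<beta>) *\<^sub>R (b - a) + (\<rho> * \<gamma>) *\<^sub>R (c - a)"
      unfolding \<alpha> by (simp add: algebra_simps)
    hence "A (\<rho> *\<^sub>R (\<alpha> *\<^sub>R a + \<beta> *\<^sub>R b + \<gamma> *\<^sub>R c) + y)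
        = f (\<rho> *\<^sub>R a + y) + (\<rho> * \<beta>) *\<^sub>R f (b - a) + (\<rho> * \<gamma>) *\<^sub>R f (c - a) + k"
      unfolding A_def by (metis linear_add[OF lf] linear_scale[OF lf])
    also have "\<dots> = \<alpha> *\<^sub>R t1 + \<beta> *\<^sub>R t2 + \<gamma> *\<^sub>R t3"
      unfolding \<alpha> fb k_def using \<rho> by (simp add: algebra_simps)
    finally show ?thesis .
  qed
  have "homothet 1 (A ` K) 0 \<subseteq> T"
  proof -
    have "A v \<in> T" if vK: "v \<in> K" for v
    proof -
      obtain \<alpha> \<beta> \<gamma> where "0 \<le> \<alpha>" "0 \<le> \<beta>" "0 \<le> \<gamma>" "\<alpha> + \<beta> + \<gamma> = 1"
        "v = \<rho> *\<^sub>R (\<alpha> *\<^sub>R a + \<beta> *\<^sub>R b + \<gamma> *\<^sub>R c) + y"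
        using sup vK by (auto simp: homothet_def convex_hull_3)
      thus ?thesis unfolding T' convex_hull_3 using At by blast
    qed
    thus ?thesis by (auto simp: homothet_def)
  qed
  moreover have "T \<subseteq> homothet \<rho> (A ` K) (f y + k - \<rho> *\<^sub>R k)"
  proof
    fix t assume "t \<in> T"
    then obtain \<alpha> \<beta> \<gamma> where n: "0 \<le> \<alpha>" "0 \<le> \<beta>" "0 \<le> \<gamma>" "\<alpha> + \<beta> + \<gamma> = 1"
      and t: "t = \<alpha> *\<^sub>R t1 + \<beta> *\<^sub>R t2 + \<gamma> *\<^sub>R t3"
      unfolding T' convex_hull_3 by blast
    define v where "v = \<alpha> *\<^sub>R a + \<beta> *\<^sub>R b + \<gamma> *\<^sub>R c"
    have "v \<in> K" using sub n unfolding v_def convex_hull_3 by blast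
    have "t = A (\<rho> *\<^sub>R v + y)" unfolding t v_def using At[OF n(4)] by simp
    also have "\<dots> = \<rho> *\<^sub>R A v + (f y + k - \<rho> *\<^sub>R k)"
      by (simp add: A_def linear_add[OF lf] linear_scale[OF lf] algebra_simps)
    finally show "t \<in> homothet \<rho> (A ` K) (f y + k - \<rho> *\<^sub>R k)"
      using \<open>v \<in> K\<close> by (auto simp: homothet_def)
  qed
  ultimately have r: "bm_ratio K T \<rho>"
    unfolding bm_ratio_def using aff \<rho>
    by (intro exI[of _ 1] exI[of _ \<rho>] exI[of _ A] exI) auto
  obtain m where m: "bm_ratio K T m" "\<And>d. bm_ratio K T d \<Longrightarrow> m \<le> d"
    using bm_ratio_minimum[OF K T r] by blast
  have "banach_mazur_distance K T = (LEAST d. bm_ratio K T d)"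
    unfolding banach_mazur_distance_def bm_ratio_def ..
  also have "\<dots> = m" using m by (intro Least_equality)
  finally show ?thesis using m(2)[OF r] by simp
qed

section \<open>Bounds for the Banach-Mazur distance\<close>

text \<open>The barycentric coordinates of the points of \<open>K\<close> are bounded below by \<open>- \<eta>1, - \<eta>2, - \<eta>3\<close>.
  Adding these constants and rescaling gives nonnegative coordinates with sum 1.\<close>

lemma subset_enlarged_triangle:
  fixes a b c :: "real^2"
  defines "D \<equiv> wedge (b - a) (c - a)"
  assumes D: "0 < D" and \<eta>: "0 \<le> \<eta>1" "0 \<le> \<eta>2" "0 \<le> \<eta>3"
    and K: "\<And>y. y \<in> K \<Longrightarrow> - (\<eta>1 * D) \<le> wedge (b - y) (c - y)"
      "\<And>y. y \<in> K \<Longrightarrow> - (\<eta>2 * D) \<le> wedge (c - y) (a - y)"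
      "\<And>y. y \<in> K \<Longrightarrow> - (\<eta>3 * D) \<le> wedge (a - y) (b - y)"
  shows "K \<subseteq> homothet (1 + (\<eta>1 + \<eta>2 + \<eta>3)) (convex hull {a, b, c})
    (- (\<eta>1 *\<^sub>R a + \<eta>2 *\<^sub>R b + \<eta>3 *\<^sub>R c))"
proof
  fix y assume y: "y \<in> K"
  define H where "H = 1 + (\<eta>1 + \<eta>2 + \<eta>3)"
  have H: "0 < H" using \<eta> by (simp add: H_def)
  define \<alpha> \<beta> \<gamma> where "\<alpha> = wedge (b - y) (c - y) / D" and "\<beta> = wedge (c - y) (a - y) / D"
    and "\<gamma> = wedge (a - y) (b - y) / D"
  have "wedge (b - y) (c - y) + wedge (c - y) (a - y) + wedge (a - y) (b - y) = D"
    by (simp add: D_def wedge_def algebra_simps)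
  hence sum: "\<alpha> + \<beta> + \<gamma> = 1"
    using D unfolding \<alpha>_def \<beta>_def \<gamma>_def by (simp add: add_divide_distrib[symmetric])
  have "D *\<^sub>R y = wedge (b - y) (c - y) *\<^sub>R a + wedge (c - y) (a - y) *\<^sub>R b
      + wedge (a - y) (b - y) *\<^sub>R c"
    by (simp add: D_def wedge_def vec_eq_iff forall_2 algebra_simps)
  hence "(1/D) *\<^sub>R (D *\<^sub>R y) = (1/D) *\<^sub>R (wedge (b - y) (c - y) *\<^sub>R a + wedge (c - y) (a - y) *\<^sub>R b
      + wedge (a - y) (b - y) *\<^sub>R c)"
    by simp
  hence yr: "y = \<alpha> *\<^sub>R a + \<beta> *\<^sub>R b + \<gamma> *\<^sub>R c"
    using D by (simp add: \<alpha>_def \<beta>_def \<gamma>_def scaleR_add_right)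
  have ge: "0 \<le> \<alpha> + \<eta>1" "0 \<le> \<beta> + \<eta>2" "0 \<le> \<gamma> + \<eta>3"
    using K[OF y] D by (simp_all add: \<alpha>_def \<beta>_def \<gamma>_def field_simps)
  define v where "v = ((\<alpha> + \<eta>1) / H) *\<^sub>R a + ((\<beta> + \<eta>2) / H) *\<^sub>R b + ((\<gamma> + \<eta>3) / H) *\<^sub>R c"
  have "(\<alpha> + \<eta>1) / H + (\<beta> + \<eta>2) / H + (\<gamma> + \<eta>3) / H = 1"
    using H sum by (simp add: add_divide_distrib[symmetric] H_def)
  hence "v \<in> convex hull {a, b, c}"
    unfolding convex_hull_3 v_def using ge H by (auto intro!: exI)
  moreover have "y = H *\<^sub>R v + - (\<eta>1 *\<^sub>R a + \<eta>2 *\<^sub>R b + \<eta>3 *\<^sub>R c)"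
    using H by (simp add: v_def yr scaleR_add_right scaleR_add_left)
  ultimately show "y \<in> homothet (1 + (\<eta>1 + \<eta>2 + \<eta>3)) (convex hull {a, b, c})
      (- (\<eta>1 *\<^sub>R a + \<eta>2 *\<^sub>R b + \<eta>3 *\<^sub>R c))"
    unfolding homothet_def H_def by blast
qed

text \<open>In an inscribed triangle of maximal area all barycentric coordinates of points of \<open>K\<close> are at most
  1. With respect to the medial triangle they are then at least \<open>-1\<close>.\<close>

lemma banach_mazur_le_4:
  assumes K: "convex_body K" and z: "0 \<in> interior K" and T: "triangle T"
  shows "banach_mazur_distance K T \<le> 4"
proof -
  have cK: "compact K" "convex K" using K by (auto simp: convex_body_def)
  have "K \<noteq> {}" using z by auto
  have cont: "continuous_on (K \<times> K \<times> K) (\<lambda>(x, y, z). wedge (y - x) (z - x))"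
    unfolding case_prod_unfold by (intro continuous_intros)
  obtain a b c where abc: "a \<in> K" "b \<in> K" "c \<in> K"
    and max: "\<And>x y z. x \<in> K \<Longrightarrow> y \<in> K \<Longrightarrow> z \<in> K \<Longrightarrow> wedge (y - x) (z - x) \<le> wedge (b - a) (c - a)"
    by (rule compact_attains_sup_three[OF cK(1) \<open>K \<noteq> {}\<close> cont]) (rule that)
  obtain a' b' c' where "balanced_triangle K a' b' c'"
    using balanced_triangle_exists[OF cK(1) z] .
  hence b': "a' \<in> K" "b' \<in> K" "c' \<in> K" "0 < wedge b' c'" "0 < wedge c' a'" "0 < wedge a' b'"
    by (auto simp: balanced_triangle_def)
  have "wedge (b' - a') (c' - a') = wedge b' c' + wedge c' a' + wedge a' b'"
    by (simp add: wedge_def algebra_simps)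
  hence D: "0 < wedge (b - a) (c - a)" using max[OF b'(1-3)] b' by linarith
  define p q r where "p = (1/2) *\<^sub>R (b + c)" and "q = (1/2) *\<^sub>R (c + a)" and "r = (1/2) *\<^sub>R (a + b)"
  have Dm: "wedge (q - p) (r - p) = wedge (b - a) (c - a) / 4"
    by (simp add: p_def q_def r_def wedge_def field_simps)
  \<comment> \<open>the passage between barycentric coordinates of the triangle and of its medial triangle\<close>
  have medial: "wedge (q - y) (r - y) = wedge (b - a) (c - a) / 4 - wedge (b - y) (c - y) / 2"
    "wedge (r - y) (p - y) = wedge (b - a) (c - a) / 4 - wedge (c - y) (a - y) / 2"
    "wedge (p - y) (q - y) = wedge (b - a) (c - a) / 4 - wedge (a - y) (b - y) / 2" for y
    by (simp_all add: p_def q_def r_def wedge_def field_simps)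
  have pqr: "p \<in> K" "q \<in> K" "r \<in> K"
    using convexD[OF cK(2), of _ _ "1/2" "1/2"] abc
    unfolding p_def q_def r_def by (simp_all add: scaleR_add_right)
  have bound: "wedge (b - y) (c - y) \<le> wedge (b - a) (c - a)"
    "wedge (c - y) (a - y) \<le> wedge (b - a) (c - a)"
    "wedge (a - y) (b - y) \<le> wedge (b - a) (c - a)" if "y \<in> K" for y
    using max[OF that abc(2,3)] max[OF that abc(3,1)] max[OF that abc(1,2)] by auto
  have "K \<subseteq> homothet (1 + (1 + 1 + 1)) (convex hull {p, q, r}) (- (1 *\<^sub>R p + 1 *\<^sub>R q + 1 *\<^sub>R r))"
  proof (rule subset_enlarged_triangle)
    fix y assume "y \<in> K"
    note bd = bound[OF this]
    show "- (1 * wedge (q - p) (r - p)) \<le> wedge (q - y) (r - y)"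
      unfolding Dm medial(1)[of y] using bd(1) by argo
    show "- (1 * wedge (q - p) (r - p)) \<le> wedge (r - y) (p - y)"
      unfolding Dm medial(2)[of y] using bd(2) by argo
    show "- (1 * wedge (q - p) (r - p)) \<le> wedge (p - y) (q - y)"
      unfolding Dm medial(3)[of y] using bd(3) by argo
  qed (use D Dm in auto)
  moreover have "\<not> collinear {p, q, r}" using D Dm by (simp add: collinear_iff_wedge)
  moreover have "convex hull {p, q, r} \<subseteq> K" using pqr cK by (simp add: hull_minimal)
  ultimately have "banach_mazur_distance K T \<le> 1 + (1 + 1 + 1)"
    by (intro banach_mazur_le[OF K T]) auto
  thus ?thesis by simp
qed

text \<open>Lower bounds for the barycentric coordinates with respect to a balanced triangle are read off
  from the heights of its sectors.\<close>

lemma banach_mazur_stability: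
  assumes K: "convex_body K" and z: "0 \<in> interior K" and \<epsilon>: "0 < \<epsilon>"
    and vol: "area K * area (polar K) \<le> (1 + \<epsilon>) * (27/4)" and T: "triangle T"
  shows "banach_mazur_distance K T \<le> 1 + 900 * \<epsilon>"
proof (cases "\<epsilon> < 1/300")
  case False
  thus ?thesis using banach_mazur_le_4[OF K z T] by simp
next
  case True
  have cK: "compact K" "convex K" using K by (auto simp: convex_body_def)
  obtain a b c where bal: "balanced_triangle K a b c"
    using balanced_triangle_exists[OF cK(1) z] .
  have b: "a \<in> K" "b \<in> K" "c \<in> K" "0 < wedge b c" "0 < wedge c a" "0 < wedge a b"
    using bal by (auto simp: balanced_triangle_def)
  obtain x1 x2 x3 where x: "1 \<le> x1" "1 \<le> x2" "1 \<le> x3"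
    "(x1 - 1) + (x2 - 1) + (x3 - 1) \<le> 16 * \<epsilon>"
    and h: "\<And>y. y \<in> K \<Longrightarrow> wedge y (c - b) \<le> x1 * wedge b c"
    "\<And>y. y \<in> K \<Longrightarrow> wedge y (a - c) \<le> x2 * wedge c a"
    "\<And>y. y \<in> K \<Longrightarrow> wedge y (b - a) \<le> x3 * wedge a b"
    by (rule balanced_triangle_stability[OF cK z bal \<epsilon> True vol]) (rule that)
  define D where "D = wedge (b - a) (c - a)"
  have Dsum: "D = wedge b c + wedge c a + wedge a b"
    by (simp add: D_def wedge_def algebra_simps)
  have D: "0 < D" using Dsum b by linarith
  have edge: "wedge (u - y) (v - y) = wedge u v - wedge y (v - u)" for u v y
    by (simp add: wedge_def algebra_simps)
  have low: "- ((x - 1) * D) \<le> w - y" if "1 \<le> x" "w \<le> D" "y \<le> x * w" for x w y :: real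
  proof -
    have "(x - 1) * w \<le> (x - 1) * D" using that by (intro mult_left_mono) auto
    thus ?thesis using that by (simp add: algebra_simps)
  qed
  let ?H = "1 + ((x1 - 1) + (x2 - 1) + (x3 - 1))"
  have "K \<subseteq> homothet ?H (convex hull {a, b, c})
      (- ((x1 - 1) *\<^sub>R a + (x2 - 1) *\<^sub>R b + (x3 - 1) *\<^sub>R c))"
  proof (rule subset_enlarged_triangle)
    fix y assume y: "y \<in> K"
    show "- ((x1 - 1) * wedge (b - a) (c - a)) \<le> wedge (b - y) (c - y)"
      unfolding D_def[symmetric] edge[of b y c]
      by (rule low[OF x(1) _ h(1)[OF y]]) (use Dsum b in linarith)
    show "- ((x2 - 1) * wedge (b - a) (c - a)) \<le> wedge (c - y) (a - y)"
      unfolding D_def[symmetric] edge[of c y a]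
      by (rule low[OF x(2) _ h(2)[OF y]]) (use Dsum b in linarith)
    show "- ((x3 - 1) * wedge (b - a) (c - a)) \<le> wedge (a - y) (b - y)"
      unfolding D_def[symmetric] edge[of a y b]
      by (rule low[OF x(3) _ h(3)[OF y]]) (use Dsum b in linarith)
  qed (use D x in \<open>auto simp: D_def\<close>)
  moreover have "\<not> collinear {a, b, c}" using D by (simp add: D_def collinear_iff_wedge)
  moreover have "convex hull {a, b, c} \<subseteq> K" using b cK by (simp add: hull_minimal)
  moreover have "0 < ?H" using x by simp
  ultimately have "banach_mazur_distance K T \<le> ?H"
    by (intro banach_mazur_le[OF K T]) auto
  thus ?thesis using x(4) \<epsilon> by simp
qed

section \<open>The position of the origin\<close>

lemma homothet_triangle:
  "homothet l (convex hull {a, b, c}) x = convex hull {l *\<^sub>R a + x, l *\<^sub>R b + x, l *\<^sub>R c + x}"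
proof -
  have e: "l *\<^sub>R (u *\<^sub>R a + v *\<^sub>R b + w *\<^sub>R c) + x
      = u *\<^sub>R (l *\<^sub>R a + x) + v *\<^sub>R (l *\<^sub>R b + x) + w *\<^sub>R (l *\<^sub>R c + x)"
    if "u + v + w = 1" for u v w
  proof -
    have "x = (u + v + w) *\<^sub>R x" using that by simp
    thus ?thesis by (simp add: scaleR_add_right scaleR_add_left mult.commute add_ac)
  qed
  show ?thesis
    unfolding homothet_def convex_hull_3 using e by (auto simp: image_iff) (metis e)+
qed

lemma wedge_nonneg_in_triangle:
  assumes "y \<in> convex hull {a, b, c}" "0 \<le> wedge (b - a) (c - a)"
  shows "0 \<le> wedge (b - y) (c - y)"
proof -
  obtain u v w where u: "0 \<le> u" "u + v + w = 1" "y = u *\<^sub>R a + v *\<^sub>R b + w *\<^sub>R c"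
    using assms(1) unfolding convex_hull_3 by blast
  have w: "w = 1 - u - v" using u by simp
  have "wedge (b - y) (c - y) = u * wedge (b - a) (c - a)"
    unfolding u(3) w by (simp add: wedge_def algebra_simps)
  thus ?thesis using u assms(2) by simp
qed

text \<open>A small positive multiple of the outer normal of the side \<open>b, c\<close> still lies in \<open>K\<close>, which
  puts the origin strictly on the inner side.\<close>

lemma edge_wedge_pos:
  assumes z: "0 \<in> interior K" and K: "K \<subseteq> convex hull {a, b, c}" and D: "0 < wedge (b - a) (c - a)"
  shows "0 < wedge b c"
proof -
  obtain e where e: "0 < e" "cball 0 e \<subseteq> K" using z mem_interior_cball by blast
  define n where "n = turn (c - b)"
  have "c \<noteq> b" using D by auto
  hence n: "n \<noteq> 0" by (auto simp: n_def turn_def vec_eq_iff forall_2)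
  define y where "y = (e / norm n) *\<^sub>R n"
  have "y \<in> K" using e n by (intro subsetD[OF e(2)]) (simp add: y_def)
  hence "0 \<le> wedge (b - y) (c - y)"
    using wedge_nonneg_in_triangle[of y a b c] K D by auto
  hence "wedge y (c - b) \<le> wedge b c" by (simp add: wedge_def algebra_simps)
  moreover have "wedge y (c - b) = (e / norm n) * (n \<bullet> n)"
    by (simp add: inner_turn[symmetric] n_def[symmetric] y_def)
  moreover have "0 < (e / norm n) * (n \<bullet> n)" using e n by simp
  ultimately show ?thesis by linarith
qed

lemma edge_normal_in_polar:
  assumes K: "K \<subseteq> convex hull {a, b, c}" and D: "0 \<le> wedge (b - a) (c - a)" "0 < wedge b c"
  shows "(1 / wedge b c) *\<^sub>R turn (c - b) \<in> polar K"
proof -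
  have "wedge y (c - b) \<le> wedge b c" if "y \<in> K" for y
  proof -
    have "0 \<le> wedge (b - y) (c - y)" using wedge_nonneg_in_triangle K D that by blast
    thus ?thesis by (simp add: wedge_def algebra_simps)
  qed
  thus ?thesis using D(2) by (auto simp: polar_def turn_inner field_simps)
qed

text \<open>The three scaled normals of the sides are the vertices of the polar of the triangle, which is
  contained in the polar of \<open>K\<close>; the last bound is the area of this dual triangle.\<close>

lemma polar_area_in_triangle:
  assumes z: "0 \<in> interior K" and K: "K \<subseteq> convex hull {a, b, c}" and D: "0 < wedge (b - a) (c - a)"
  shows "0 < wedge b c" "0 < wedge c a" "0 < wedge a b"
    and "(wedge (b - a) (c - a))\<^sup>2 / (2 * (wedge b c * wedge c a * wedge a b)) \<le> area (polar K)"
proof -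
  have K': "K \<subseteq> convex hull {b, c, a}" "K \<subseteq> convex hull {c, a, b}"
    using K by (simp_all add: insert_commute)
  have cyc: "wedge (c - b) (a - b) = wedge (b - a) (c - a)" "wedge (a - c) (b - c) = wedge (b - a) (c - a)"
    by (simp_all add: wedge_def algebra_simps)
  show pos: "0 < wedge b c" "0 < wedge c a" "0 < wedge a b"
    using edge_wedge_pos[OF z K D] edge_wedge_pos[OF z K'(1)] edge_wedge_pos[OF z K'(2)] D cyc by auto
  define D1 D2 D3 E where "D1 = wedge b c" and "D2 = wedge c a" and "D3 = wedge a b"
    and "E = wedge (b - a) (c - a)"
  have D': "0 < D1" "0 < D2" "0 < D3" "E = D1 + D2 + D3"
    using pos by (simp_all add: D1_def D2_def D3_def E_def wedge_def algebra_simps)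
  define u v w where "u = (1 / D1) *\<^sub>R turn (c - b)" and "v = (1 / D2) *\<^sub>R turn (a - c)"
    and "w = (1 / D3) *\<^sub>R turn (b - a)"
  have uvw: "u \<in> polar K" "v \<in> polar K" "w \<in> polar K"
    unfolding u_def v_def w_def D1_def D2_def D3_def
    using edge_normal_in_polar[OF K] edge_normal_in_polar[OF K'(1)] edge_normal_in_polar[OF K'(2)]
      pos D cyc by auto
  have "wedge u v = E / (D1 * D2)" "wedge v w = E / (D2 * D3)" "wedge w u = E / (D3 * D1)"
    unfolding u_def v_def w_def
    by (simp_all add: wedge_algebra(5,6) wedge_turn inner_turn)
      (simp_all add: E_def wedge_def algebra_simps)
  moreover have "wedge (v - u) (w - u) = wedge u v + wedge v w + wedge w u"
    by (simp add: wedge_def algebra_simps)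
  moreover have "E / (D1 * D2) + E / (D2 * D3) + E / (D3 * D1) = E\<^sup>2 / (D1 * D2 * D3)"
    unfolding D'(4) using D'(1-3) by (simp add: field_simps power2_eq_square)
  ultimately have "wedge (v - u) (w - u) = E\<^sup>2 / (D1 * D2 * D3)" by simp
  hence "area (convex hull {u, v, w}) = E\<^sup>2 / (2 * (D1 * D2 * D3))"
    using D' by (simp add: triangle_area)
  moreover have "area (convex hull {u, v, w}) \<le> area (polar K)"
  proof (rule measure_mono_fmeasurable)
    show "convex hull {u, v, w} \<subseteq> polar K"
      using uvw by (simp add: hull_minimal convex_polar)
    show "convex hull {u, v, w} \<in> sets lebesgue"
      by (intro fmeasurableD lmeasurable_compact) (simp add: compact_convex_hull finite_imp_compact)
    show "polar K \<in> lmeasurable" by (rule lmeasurable_compact[OF compact_polar[OF z]])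
  qed
  ultimately show "(wedge (b - a) (c - a))\<^sup>2 / (2 * (wedge b c * wedge c a * wedge a b)) \<le> area (polar K)"
    by (simp add: E_def D1_def D2_def D3_def)
qed

text \<open>The area of \<open>K\<close> is at least that of the inner triangle, and the area of its polar at least that
  of the polar of the outer one. For the outer triangle and its polar the product is
  \<open>1 / (4 * (m1 * m2 * m3))\<close>, where the \<open>m\<close> are the barycentric coordinates of the origin.\<close>

lemma triangle_ratio_le_volume_product:
  assumes K: "convex_body K" "0 \<in> interior K"
    and sub: "convex hull {l1 *\<^sub>R a + x, l1 *\<^sub>R b + x, l1 *\<^sub>R c + x} \<subseteq> K"
    and sup: "K \<subseteq> convex hull {A, B, C}"
    and ABC: "A = l2 *\<^sub>R a + x" "B = l2 *\<^sub>R b + x" "C = l2 *\<^sub>R c + x"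
    and D: "0 < wedge (b - a) (c - a)" and l: "0 < l1" "0 < l2"
    and m: "m1 = wedge B C / wedge (B - A) (C - A)" "m2 = wedge C A / wedge (B - A) (C - A)"
      "m3 = wedge A B / wedge (B - A) (C - A)"
    and vol: "area K * area (polar K) \<le> (1 + \<epsilon>) * (27/4)"
  shows "(l1 / l2)\<^sup>2 \<le> 27 * (m1 * m2 * m3) * (1 + \<epsilon>)" "0 < m1" "0 < m2" "0 < m3"
proof -
  define E where "E = wedge (B - A) (C - A)"
  have El: "E = l2\<^sup>2 * wedge (b - a) (c - a)"
    by (simp add: E_def ABC wedge_def algebra_simps power2_eq_square)
  have E: "0 < E" using D l El by simp
  note pol = polar_area_in_triangle[OF K(2) sup E[unfolded E_def]]
  show mpos: "0 < m1" "0 < m2" "0 < m3"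
    using pol(1-3) E unfolding m E_def by simp_all
  have "area (convex hull {l1 *\<^sub>R a + x, l1 *\<^sub>R b + x, l1 *\<^sub>R c + x}) \<le> area K"
  proof (rule measure_mono_fmeasurable[OF sub])
    show "convex hull {l1 *\<^sub>R a + x, l1 *\<^sub>R b + x, l1 *\<^sub>R c + x} \<in> sets lebesgue"
      by (intro fmeasurableD lmeasurable_compact) (simp add: compact_convex_hull finite_imp_compact)
    show "K \<in> lmeasurable" using K(1) by (simp add: convex_body_def lmeasurable_compact)
  qed
  moreover have "wedge (l1 *\<^sub>R b + x - (l1 *\<^sub>R a + x)) (l1 *\<^sub>R c + x - (l1 *\<^sub>R a + x))
      = l1\<^sup>2 * wedge (b - a) (c - a)"
    by (simp add: wedge_def algebra_simps power2_eq_square)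
  ultimately have "l1\<^sup>2 * wedge (b - a) (c - a) / 2 \<le> area K"
    using D by (simp add: triangle_area)
  moreover have "l1\<^sup>2 * wedge (b - a) (c - a) = (l1 / l2)\<^sup>2 * E"
    using l by (simp add: El power_divide)
  ultimately have aK: "(l1 / l2)\<^sup>2 * E / 2 \<le> area K" by simp
  have "E\<^sup>2 / (2 * (wedge B C * wedge C A * wedge A B)) \<le> area (polar K)"
    using pol(4) by (simp add: E_def)
  moreover have "wedge B C = m1 * E" "wedge C A = m2 * E" "wedge A B = m3 * E"
    using E unfolding m E_def by simp_all
  ultimately have aP: "1 / (2 * E * (m1 * m2 * m3)) \<le> area (polar K)"
    using E mpos by (simp add: field_simps power2_eq_square)
  have "((l1 / l2)\<^sup>2 * E / 2) * (1 / (2 * E * (m1 * m2 * m3))) \<le> area K * area (polar K)"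
    using aK aP E mpos by (intro mult_mono) auto
  also have "\<dots> \<le> (1 + \<epsilon>) * (27/4)" by (rule vol)
  finally have le: "((l1 / l2)\<^sup>2 * E / 2) * (1 / (2 * E * (m1 * m2 * m3))) \<le> (1 + \<epsilon>) * (27/4)" .
  have "((l1 / l2)\<^sup>2 * E / 2) * (1 / (2 * E * (m1 * m2 * m3))) = (l1 / l2)\<^sup>2 / (4 * (m1 * m2 * m3))"
    using E mpos by simp
  hence "(l1 / l2)\<^sup>2 / (4 * (m1 * m2 * m3)) \<le> (1 + \<epsilon>) * (27/4)" using le by simp
  hence "(l1 / l2)\<^sup>2 \<le> (1 + \<epsilon>) * (27/4) * (4 * (m1 * m2 * m3))"
    using mpos by (simp add: pos_divide_le_eq)
  also have "\<dots> = 27 * (m1 * m2 * m3) * (1 + \<epsilon>)" by (simp add: field_simps)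
  finally show "(l1 / l2)\<^sup>2 \<le> 27 * (m1 * m2 * m3) * (1 + \<epsilon>)" .
qed

text \<open>With the second elementary symmetric function \<open>e2\<close> of the coordinates the first claim reads
  \<open>9 * (u * v * w) \<le> (u + v + w) * e2\<close>, and the difference of the two sides is a combination of
  squares with the coordinates as coefficients.\<close>

lemma barycentric_deviation_le:
  fixes u v w :: real
  assumes "u + v + w = 1" "0 \<le> u" "0 \<le> v" "0 \<le> w"
  shows "3/2 * ((1/3 - u)\<^sup>2 + (1/3 - v)\<^sup>2 + (1/3 - w)\<^sup>2) \<le> 1 - 27 * (u * v * w)"
    and "(1/3 - u)\<^sup>2 + (1/3 - v)\<^sup>2 + (1/3 - w)\<^sup>2 \<le> 2/3"
    and "27 * (u * v * w) \<le> 1"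
proof -
  have w: "w = 1 - u - v" using assms(1) by simp
  have "0 \<le> u * (v - w)\<^sup>2 + v * (w - u)\<^sup>2 + w * (u - v)\<^sup>2" using assms by simp
  also have "\<dots> = (1 - 27 * (u * v * w) - 3/2 * ((1/3 - u)\<^sup>2 + (1/3 - v)\<^sup>2 + (1/3 - w)\<^sup>2)) / 3"
    unfolding w by (simp add: power2_eq_square field_simps)
  finally show 1: "3/2 * ((1/3 - u)\<^sup>2 + (1/3 - v)\<^sup>2 + (1/3 - w)\<^sup>2) \<le> 1 - 27 * (u * v * w)" by simp
  have "0 \<le> u * v * w" using assms by simp
  with 1 show "(1/3 - u)\<^sup>2 + (1/3 - v)\<^sup>2 + (1/3 - w)\<^sup>2 \<le> 2/3" by argo
  have "0 \<le> 3/2 * ((1/3 - u)\<^sup>2 + (1/3 - v)\<^sup>2 + (1/3 - w)\<^sup>2)" by simp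
  with 1 show "27 * (u * v * w) \<le> 1" by linarith
qed

text \<open>In the norm making the scaled triangle regular of side 1, the inner products of its edge vectors are
  known. The vectors with coefficient sum 0 are the combinations of these.\<close>

lemma regularizing_norm_formula:
  assumes nc: "\<not> collinear {a, b, c}" and m: "0 < m" and sum: "\<delta>1 + \<delta>2 + \<delta>3 = 0"
  shows "regularizing_norm (homothet m (convex hull {a, b, c}) 0) (\<delta>1 *\<^sub>R a + \<delta>2 *\<^sub>R b + \<delta>3 *\<^sub>R c)
      = sqrt ((\<delta>1\<^sup>2 + \<delta>2\<^sup>2 + \<delta>3\<^sup>2) / 2) / m"
proof -
  define T where "T = homothet m (convex hull {a, b, c}) 0"
  have T: "T = convex hull {m *\<^sub>R a, m *\<^sub>R b, m *\<^sub>R c}" by (simp add: T_def homothet_triangle)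
  have "wedge (m *\<^sub>R b - m *\<^sub>R a) (m *\<^sub>R c - m *\<^sub>R a) = m\<^sup>2 * wedge (b - a) (c - a)"
    by (simp add: wedge_def power2_eq_square algebra_simps)
  hence nc': "\<not> collinear {m *\<^sub>R a, m *\<^sub>R b, m *\<^sub>R c}"
    using nc m by (simp add: collinear_iff_wedge)
  hence "triangle T" unfolding triangle_def T by blast
  from theI'[OF ex1_regularizing_norm[OF this]]
  have N: "euclidean_norm (regularizing_norm T)" "regular_triangle_wrt (regularizing_norm T) 1 T"
    unfolding regularizing_norm_def by auto
  obtain B where bl: "bilinear B" and sym: "\<And>u v. B u v = B v u"
    and NB: "regularizing_norm T = (\<lambda>v. sqrt (B v v))"
    using N(1) unfolding euclidean_norm_def inner_product_def by blast
  note s = bilinear_ladd[OF bl] bilinear_radd[OF bl] bilinear_lsub[OF bl] bilinear_rsub[OF bl]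
    bilinear_lmul[OF bl] bilinear_rmul[OF bl]
  have d: "m *\<^sub>R a \<noteq> m *\<^sub>R b" "m *\<^sub>R a \<noteq> m *\<^sub>R c" "m *\<^sub>R b \<noteq> m *\<^sub>R c"
    using nc' by (auto simp: insert_commute)
  define u v where "u = b - a" and "v = c - a"
  have side: "B (m *\<^sub>R p) (m *\<^sub>R p) = 1 \<Longrightarrow> B p p = 1 / m\<^sup>2" for p
    using m by (simp add: s field_simps power2_eq_square)
  have "regularizing_norm T (m *\<^sub>R b - m *\<^sub>R a) = 1" "regularizing_norm T (m *\<^sub>R c - m *\<^sub>R a) = 1"
    "regularizing_norm T (m *\<^sub>R c - m *\<^sub>R b) = 1"
    using N(2) d vertices_triangle[OF nc', folded T] unfolding regular_triangle_wrt_def by auto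
  moreover have "v - u = c - b" by (simp add: u_def v_def)
  ultimately have "sqrt (B (m *\<^sub>R u) (m *\<^sub>R u)) = 1" "sqrt (B (m *\<^sub>R v) (m *\<^sub>R v)) = 1"
    "sqrt (B (m *\<^sub>R (v - u)) (m *\<^sub>R (v - u))) = 1"
    unfolding NB u_def v_def by (simp_all only: scaleR_diff_right)
  hence b: "B u u = 1 / m\<^sup>2" "B v v = 1 / m\<^sup>2" "B (v - u) (v - u) = 1 / m\<^sup>2"
    by (auto intro!: side)
  have "B (v - u) (v - u) = B u u - 2 * B u v + B v v" using sym[of v u] by (simp add: s)
  hence uv: "2 * B u v = 1 / m\<^sup>2" using b by simp
  have \<delta>1: "\<delta>1 = - \<delta>2 - \<delta>3" using sum by simp
  have "\<delta>1 *\<^sub>R a + \<delta>2 *\<^sub>R b + \<delta>3 *\<^sub>R c = \<delta>2 *\<^sub>R u + \<delta>3 *\<^sub>R v"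
    unfolding \<delta>1 by (simp add: u_def v_def algebra_simps)
  moreover have "B (\<delta>2 *\<^sub>R u + \<delta>3 *\<^sub>R v) (\<delta>2 *\<^sub>R u + \<delta>3 *\<^sub>R v)
      = \<delta>2\<^sup>2 * B u u + \<delta>2 * \<delta>3 * (2 * B u v) + \<delta>3\<^sup>2 * B v v"
    using sym[of v u] by (simp add: s algebra_simps power2_eq_square)
  moreover have "\<dots> = ((\<delta>1\<^sup>2 + \<delta>2\<^sup>2 + \<delta>3\<^sup>2) / 2) / m\<^sup>2"
    unfolding uv b \<delta>1 using m by (simp add: power2_eq_square field_simps)
  ultimately show ?thesis
    unfolding T_def[symmetric] NB using m by (simp add: real_sqrt_divide real_sqrt_mult)
qed

text \<open>Writing the centre in terms of the barycentric coordinates of the origin separates two contributions: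
  \<open>\<mu>\<close> refers to the outer triangle and is controlled by the volume product, while \<open>\<nu>\<close> refers to
  the unscaled \<open>T\<close> and enters with the small factor \<open>m - l2\<close> only.\<close>

lemma centre_near_origin:
  assumes K: "convex_body K" "0 \<in> interior K" and \<epsilon>: "0 < \<epsilon>"
    and vol: "area K * area (polar K) \<le> (1 + \<epsilon>) * (27/4)"
    and T: "triangle T" and l: "0 < l1" "0 < l2"
    and sub: "homothet l1 T x \<subseteq> K" and sup: "K \<subseteq> homothet l2 T x"
    and ratio: "l2 / l1 \<le> 1 + 900 * \<epsilon>" "1 + 900 * \<epsilon> < 4"
  shows "regularizing_norm (homothet ((l1 + l2) / 2) T 0)
          (triangle_centre (homothet ((l1 + l2) / 2) T x)) \<le> 917 * sqrt \<epsilon>"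
proof -
  obtain a b c where nc: "\<not> collinear {a, b, c}" and T': "T = convex hull {a, b, c}"
    and D: "0 < wedge (b - a) (c - a)"
  proof -
    obtain a b c where *: "\<not> collinear {a, b, c}" "T = convex hull {a, b, c}"
      using T unfolding triangle_def by blast
    show ?thesis
    proof (cases "0 < wedge (b - a) (c - a)")
      case True
      thus ?thesis using * that by blast
    next
      case False
      hence "0 < wedge (c - a) (b - a)"
        using *(1) wedge_swap[of "c - a" "b - a"] by (simp add: collinear_iff_wedge)
      moreover have "{a, b, c} = {a, c, b}" by auto
      ultimately show ?thesis using * that by metis
    qed
  qed
  define m where "m = (l1 + l2) / 2"
  have m: "0 < m" using l by (simp add: m_def)
  define A B C where "A = l2 *\<^sub>R a + x" and "B = l2 *\<^sub>R b + x" and "C = l2 *\<^sub>R c + x"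
  define E where "E = wedge (B - A) (C - A)"
  have E: "E = l2\<^sup>2 * wedge (b - a) (c - a)"
    by (simp add: E_def A_def B_def C_def wedge_def algebra_simps power2_eq_square)
  have E0: "0 < E" using D l E by simp
  define \<mu>1 \<mu>2 \<mu>3 where "\<mu>1 = wedge B C / E" and "\<mu>2 = wedge C A / E" and "\<mu>3 = wedge A B / E"
  have sub': "convex hull {l1 *\<^sub>R a + x, l1 *\<^sub>R b + x, l1 *\<^sub>R c + x} \<subseteq> K"
    and sup': "K \<subseteq> convex hull {A, B, C}"
    using sub sup unfolding T' homothet_triangle A_def B_def C_def by auto
  have \<mu>: "(l1 / l2)\<^sup>2 \<le> 27 * (\<mu>1 * \<mu>2 * \<mu>3) * (1 + \<epsilon>)" "0 < \<mu>1" "0 < \<mu>2" "0 < \<mu>3"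
    using triangle_ratio_le_volume_product[OF K sub' sup' A_def B_def C_def D l
        \<mu>1_def[unfolded E_def] \<mu>2_def[unfolded E_def] \<mu>3_def[unfolded E_def] vol] by blast+
  have \<mu>sum: "\<mu>1 + \<mu>2 + \<mu>3 = 1"
  proof -
    have "wedge B C + wedge C A + wedge A B = E" by (simp add: E_def wedge_def algebra_simps)
    thus ?thesis using E0 unfolding \<mu>1_def \<mu>2_def \<mu>3_def by (simp add: add_divide_distrib[symmetric])
  qed
  have \<mu>0: "\<mu>1 *\<^sub>R A + \<mu>2 *\<^sub>R B + \<mu>3 *\<^sub>R C = 0"
  proof -
    have "wedge B C *\<^sub>R A + wedge C A *\<^sub>R B + wedge A B *\<^sub>R C = 0"
      by (simp add: wedge_def vec_eq_iff forall_2 algebra_simps)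
    hence "(1 / E) *\<^sub>R (wedge B C *\<^sub>R A + wedge C A *\<^sub>R B + wedge A B *\<^sub>R C) = 0" by simp
    thus ?thesis by (simp add: scaleR_add_right \<mu>1_def \<mu>2_def \<mu>3_def)
  qed
  define F where "F = wedge (b - a) (c - a)"
  define \<nu>1 \<nu>2 \<nu>3 where "\<nu>1 = wedge b c / F" and "\<nu>2 = wedge c a / F" and "\<nu>3 = wedge a b / F"
  have \<nu>sum: "\<nu>1 + \<nu>2 + \<nu>3 = 1"
  proof -
    have "wedge b c + wedge c a + wedge a b = F" by (simp add: F_def wedge_def algebra_simps)
    thus ?thesis
      using D unfolding \<nu>1_def \<nu>2_def \<nu>3_def F_def by (simp add: add_divide_distrib[symmetric])
  qed
  have \<nu>0: "\<nu>1 *\<^sub>R a + \<nu>2 *\<^sub>R b + \<nu>3 *\<^sub>R c = 0"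
  proof -
    have "wedge b c *\<^sub>R a + wedge c a *\<^sub>R b + wedge a b *\<^sub>R c = 0"
      by (simp add: wedge_def vec_eq_iff forall_2 algebra_simps)
    hence "(1 / F) *\<^sub>R (wedge b c *\<^sub>R a + wedge c a *\<^sub>R b + wedge a b *\<^sub>R c) = 0" by simp
    thus ?thesis by (simp add: scaleR_add_right \<nu>1_def \<nu>2_def \<nu>3_def)
  qed
  \<comment> \<open>the inner triangle lies in the outer one; this forces \<open>l1 \<le> l2\<close>, and places the origin in \<open>T\<close> if the inequality is strict\<close>
  have \<nu>pos: "0 \<le> (l2 - l1) * \<nu>1" "0 \<le> (l2 - l1) * \<nu>2" "0 \<le> (l2 - l1) * \<nu>3"
  proof -
    have in1: "l1 *\<^sub>R a + x \<in> convex hull {A, B, C}" "l1 *\<^sub>R b + x \<in> convex hull {A, B, C}"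
      "l1 *\<^sub>R c + x \<in> convex hull {A, B, C}"
      using sub' sup' hull_inc[of _ "{l1 *\<^sub>R a + x, l1 *\<^sub>R b + x, l1 *\<^sub>R c + x}" convex] by blast+
    have rot: "convex hull {A, B, C} = convex hull {B, C, A}" "convex hull {A, B, C} = convex hull {C, A, B}"
      by (simp_all add: insert_commute)
    have Erot: "wedge (C - B) (A - B) = E" "wedge (A - C) (B - C) = E"
      by (simp_all add: E_def wedge_def algebra_simps)
    have "0 \<le> wedge (B - (l1 *\<^sub>R b + x)) (C - (l1 *\<^sub>R b + x))"
      using wedge_nonneg_in_triangle[OF in1(2)] E0 by (simp add: E_def)
    moreover have "wedge (B - (l1 *\<^sub>R b + x)) (C - (l1 *\<^sub>R b + x)) = l2 * ((l2 - l1) * wedge b c)"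
      by (simp add: B_def C_def wedge_def algebra_simps)
    moreover have "0 \<le> wedge (C - (l1 *\<^sub>R c + x)) (A - (l1 *\<^sub>R c + x))"
      using wedge_nonneg_in_triangle[OF in1(3)[unfolded rot(1)]] E0 Erot by simp
    moreover have "wedge (C - (l1 *\<^sub>R c + x)) (A - (l1 *\<^sub>R c + x)) = l2 * ((l2 - l1) * wedge c a)"
      by (simp add: C_def A_def wedge_def algebra_simps)
    moreover have "0 \<le> wedge (A - (l1 *\<^sub>R a + x)) (B - (l1 *\<^sub>R a + x))"
      using wedge_nonneg_in_triangle[OF in1(1)[unfolded rot(2)]] E0 Erot by simp
    moreover have "wedge (A - (l1 *\<^sub>R a + x)) (B - (l1 *\<^sub>R a + x)) = l2 * ((l2 - l1) * wedge a b)"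
      by (simp add: A_def B_def wedge_def algebra_simps)
    ultimately have "0 \<le> (l2 - l1) * wedge b c" "0 \<le> (l2 - l1) * wedge c a" "0 \<le> (l2 - l1) * wedge a b"
      using l(2) by (simp_all add: zero_le_mult_iff)
    thus "0 \<le> (l2 - l1) * \<nu>1" "0 \<le> (l2 - l1) * \<nu>2" "0 \<le> (l2 - l1) * \<nu>3"
      using D by (simp_all add: \<nu>1_def \<nu>2_def \<nu>3_def F_def zero_le_divide_iff)
  qed
  have l12: "l1 \<le> l2"
  proof -
    have "0 \<le> (l2 - l1) * (\<nu>1 + \<nu>2 + \<nu>3)" using \<nu>pos by (simp add: distrib_left)
    thus ?thesis unfolding \<nu>sum by simp
  qed
  define V where "V = (1/3 - \<nu>1)\<^sup>2 + (1/3 - \<nu>2)\<^sup>2 + (1/3 - \<nu>3)\<^sup>2"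
  define U where "U = (1/3 - \<mu>1)\<^sup>2 + (1/3 - \<mu>2)\<^sup>2 + (1/3 - \<mu>3)\<^sup>2"
  have V: "((m - l2) / m)\<^sup>2 * V \<le> (900 * \<epsilon>)\<^sup>2 * (2/3)"
  proof (cases "l1 = l2")
    case True
    thus ?thesis by (simp add: m_def)
  next
    case False
    hence "0 \<le> \<nu>1" "0 \<le> \<nu>2" "0 \<le> \<nu>3" using \<nu>pos l12 by (simp_all add: zero_le_mult_iff)
    hence "V \<le> 2/3" unfolding V_def using barycentric_deviation_le(2)[OF \<nu>sum] by blast
    moreover have "\<bar>(m - l2) / m\<bar> \<le> 900 * \<epsilon>"
    proof -
      have "\<bar>(m - l2) / m\<bar> = (l2 - l1) / (l1 + l2)"
        using l l12 by (simp add: m_def abs_divide field_simps)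
      also have "\<dots> \<le> (l2 - l1) / l1" using l l12 by (intro divide_left_mono) auto
      also have "\<dots> = l2 / l1 - 1" using l by (simp add: diff_divide_distrib)
      also have "\<dots> \<le> 900 * \<epsilon>" using ratio by simp
      finally show ?thesis .
    qed
    hence "((m - l2) / m)\<^sup>2 \<le> (900 * \<epsilon>)\<^sup>2" by (metis abs_ge_zero power2_abs power_mono)
    ultimately show ?thesis by (intro mult_mono) (auto simp: V_def)
  qed
  have U: "U \<le> 1201 * \<epsilon>"
  proof -
    define \<kappa> where "\<kappa> = l1 / l2"
    have \<kappa>: "0 < \<kappa>" "\<kappa> \<le> 1" using l l12 by (simp_all add: \<kappa>_def)
    have "1 - 900 * \<epsilon> \<le> \<kappa>"
    proof -
      have "1 = \<kappa> * (l2 / l1)" using l by (simp add: \<kappa>_def)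
      also have "\<dots> \<le> \<kappa> * (1 + 900 * \<epsilon>)" using ratio(1) \<kappa> by (intro mult_left_mono) auto
      also have "\<dots> \<le> \<kappa> + 1 * (900 * \<epsilon>)" unfolding distrib_left
        using \<kappa> \<epsilon> by (intro add_mono mult_right_mono) auto
      finally show ?thesis by simp
    qed
    moreover have "0 \<le> (\<kappa> - 1)\<^sup>2" by simp
    hence "2 * \<kappa> - 1 \<le> \<kappa>\<^sup>2" by (simp add: power2_eq_square algebra_simps)
    ultimately have k2: "1 - 1800 * \<epsilon> \<le> \<kappa>\<^sup>2" by linarith
    note dev = barycentric_deviation_le[OF \<mu>sum less_imp_le[OF \<mu>(2)] less_imp_le[OF \<mu>(3)]
        less_imp_le[OF \<mu>(4)]]
    define P where "P = 27 * (\<mu>1 * \<mu>2 * \<mu>3)"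
    have "\<kappa>\<^sup>2 \<le> P * (1 + \<epsilon>)" using \<mu>(1) by (simp add: P_def \<kappa>_def)
    moreover have "P * \<epsilon> \<le> 1 * \<epsilon>" using dev(3) \<epsilon> by (intro mult_right_mono) (auto simp: P_def)
    ultimately have "1 - P \<le> 1801 * \<epsilon>" using k2 by (simp add: distrib_left)
    moreover have "3/2 * U \<le> 1 - P" using dev(1) by (simp add: U_def P_def)
    ultimately show ?thesis using \<epsilon> by linarith
  qed
  define \<delta> where "\<delta> \<nu> \<mu> = (m - l2) * (1/3 - \<nu>) + l2 * (1/3 - \<mu>)" for \<nu> \<mu> :: real
  have \<delta>sum: "\<delta> \<nu>1 \<mu>1 + \<delta> \<nu>2 \<mu>2 + \<delta> \<nu>3 \<mu>3 = 0"
  proof -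
    have "\<delta> \<nu>1 \<mu>1 + \<delta> \<nu>2 \<mu>2 + \<delta> \<nu>3 \<mu>3
        = (m - l2) * (1 - (\<nu>1 + \<nu>2 + \<nu>3)) + l2 * (1 - (\<mu>1 + \<mu>2 + \<mu>3))"
      unfolding \<delta>_def by algebra
    thus ?thesis unfolding \<nu>sum \<mu>sum by simp
  qed
  have centre: "triangle_centre (homothet m T x) = \<delta> \<nu>1 \<mu>1 *\<^sub>R a + \<delta> \<nu>2 \<mu>2 *\<^sub>R b + \<delta> \<nu>3 \<mu>3 *\<^sub>R c"
  proof -
    have "wedge ((m *\<^sub>R b + x) - (m *\<^sub>R a + x)) ((m *\<^sub>R c + x) - (m *\<^sub>R a + x)) = m\<^sup>2 * wedge (b - a) (c - a)"
      by (simp add: wedge_def algebra_simps power2_eq_square)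
    hence "\<not> collinear {m *\<^sub>R a + x, m *\<^sub>R b + x, m *\<^sub>R c + x}"
      unfolding collinear_iff_wedge using D m by simp
    hence cen: "triangle_centre (homothet m T x)
        = (1/3) *\<^sub>R ((m *\<^sub>R a + x) + (m *\<^sub>R b + x) + (m *\<^sub>R c + x))"
      unfolding T' homothet_triangle by (rule triangle_centre_convex_hull)
    have "(\<mu>1 + \<mu>2 + \<mu>3) *\<^sub>R x = - (l2 *\<^sub>R (\<mu>1 *\<^sub>R a + \<mu>2 *\<^sub>R b + \<mu>3 *\<^sub>R c))"
      using \<mu>0 unfolding A_def B_def C_def eq_neg_iff_add_eq_0 by (simp add: algebra_simps)
    hence xx: "x = - (l2 *\<^sub>R (\<mu>1 *\<^sub>R a + \<mu>2 *\<^sub>R b + \<mu>3 *\<^sub>R c))" unfolding \<mu>sum by simp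
    have \<delta>': "\<delta> \<nu> \<mu> = m / 3 - (m - l2) * \<nu> - l2 * \<mu>" for \<nu> \<mu>
      by (simp add: \<delta>_def field_simps)
    have "\<delta> \<nu>1 \<mu>1 *\<^sub>R a + \<delta> \<nu>2 \<mu>2 *\<^sub>R b + \<delta> \<nu>3 \<mu>3 *\<^sub>R c
        = (m / 3) *\<^sub>R (a + b + c) - (m - l2) *\<^sub>R (\<nu>1 *\<^sub>R a + \<nu>2 *\<^sub>R b + \<nu>3 *\<^sub>R c)
          - l2 *\<^sub>R (\<mu>1 *\<^sub>R a + \<mu>2 *\<^sub>R b + \<mu>3 *\<^sub>R c)"
      unfolding \<delta>' by (simp add: algebra_simps)
    also have "\<dots> = (m / 3) *\<^sub>R (a + b + c) + x" unfolding \<nu>0 using xx by simp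
    also have "\<dots> = (1/3) *\<^sub>R ((m *\<^sub>R a + x) + (m *\<^sub>R b + x) + (m *\<^sub>R c + x))"
    proof -
      have "x = (1/3) *\<^sub>R (x + x + x)" by (simp add: vec_eq_iff)
      thus ?thesis by (simp add: algebra_simps)
    qed
    finally show ?thesis using cen by simp
  qed
  have sq: "(p + q)\<^sup>2 \<le> 2 * p\<^sup>2 + 2 * q\<^sup>2" for p q :: real
  proof -
    have "0 \<le> (p - q)\<^sup>2" by simp
    thus ?thesis by (simp add: power2_eq_square algebra_simps)
  qed
  have "(\<delta> \<nu>1 \<mu>1)\<^sup>2 + (\<delta> \<nu>2 \<mu>2)\<^sup>2 + (\<delta> \<nu>3 \<mu>3)\<^sup>2 \<le> 2 * ((m - l2)\<^sup>2 * V) + 2 * (l2\<^sup>2 * U)"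
    using sq[of "(m - l2) * (1/3 - \<nu>1)" "l2 * (1/3 - \<mu>1)"]
      sq[of "(m - l2) * (1/3 - \<nu>2)" "l2 * (1/3 - \<mu>2)"] sq[of "(m - l2) * (1/3 - \<nu>3)" "l2 * (1/3 - \<mu>3)"]
    unfolding \<delta>_def V_def U_def power_mult_distrib distrib_left by linarith
  hence "((\<delta> \<nu>1 \<mu>1)\<^sup>2 + (\<delta> \<nu>2 \<mu>2)\<^sup>2 + (\<delta> \<nu>3 \<mu>3)\<^sup>2) / 2 / m\<^sup>2
      \<le> ((m - l2)\<^sup>2 * V + l2\<^sup>2 * U) / m\<^sup>2"
    by (intro divide_right_mono) auto
  also have "\<dots> = ((m - l2) / m)\<^sup>2 * V + (l2 / m)\<^sup>2 * U"
    by (simp add: power_divide add_divide_distrib)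
  also have "\<dots> \<le> (900 * \<epsilon>)\<^sup>2 * (2/3) + 2\<^sup>2 * (1201 * \<epsilon>)"
  proof (intro add_mono V mult_mono U power_mono)
    show "l2 / m \<le> 2" using l by (simp add: m_def field_simps)
  qed (use l m in \<open>auto simp: U_def\<close>)
  also have "\<dots> \<le> 917\<^sup>2 * \<epsilon>"
  proof -
    have "\<epsilon> * \<epsilon> \<le> (1/300) * \<epsilon>" using \<epsilon> ratio(2) by (intro mult_right_mono) auto
    thus ?thesis using \<epsilon> by (simp add: power2_eq_square)
  qed
  finally have fin: "((\<delta> \<nu>1 \<mu>1)\<^sup>2 + (\<delta> \<nu>2 \<mu>2)\<^sup>2 + (\<delta> \<nu>3 \<mu>3)\<^sup>2) / 2 / m\<^sup>2 \<le> 917\<^sup>2 * \<epsilon>" .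
  have "regularizing_norm (homothet m T 0) (triangle_centre (homothet m T x))
      = sqrt (((\<delta> \<nu>1 \<mu>1)\<^sup>2 + (\<delta> \<nu>2 \<mu>2)\<^sup>2 + (\<delta> \<nu>3 \<mu>3)\<^sup>2) / 2) / m"
    unfolding centre unfolding T' by (rule regularizing_norm_formula[OF nc m \<delta>sum])
  also have "\<dots> = sqrt (((\<delta> \<nu>1 \<mu>1)\<^sup>2 + (\<delta> \<nu>2 \<mu>2)\<^sup>2 + (\<delta> \<nu>3 \<mu>3)\<^sup>2) / 2 / m\<^sup>2)"
    using m by (simp add: real_sqrt_divide real_sqrt_mult)
  also have "\<dots> \<le> sqrt (917\<^sup>2 * \<epsilon>)" using fin by (rule real_sqrt_le_mono)
  also have "\<dots> = 917 * sqrt \<epsilon>" by (simp add: real_sqrt_mult)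
  finally show ?thesis by (simp add: m_def)
qed

theorem theorem2:
  fixes K :: "(real^2) set" and \<epsilon> :: real
  assumes "convex_body K"
    and "0 \<in> interior K"
    and "\<epsilon> > 0"
    and "area K * area (polar K) \<le> (1 + \<epsilon>) * (27/4)"
  shows "(\<forall>T. triangle T \<longrightarrow> banach_mazur_distance K T \<le> 1 + 900 * \<epsilon>) \<and>
    (\<forall>T x l1 l2. triangle T \<and> 0 < l1 \<and> 0 < l2 \<and>
        homothet l1 T x \<subseteq> K \<and> K \<subseteq> homothet l2 T x \<and>
        l2 / l1 \<le> 1 + 900 * \<epsilon> \<and> 1 + 900 * \<epsilon> < 4 \<longrightarrow>
      regularizing_norm (homothet ((l1 + l2) / 2) T 0)
          (triangle_centre (homothet ((l1 + l2) / 2) T x)) \<le> 917 * sqrt \<epsilon>)"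
  using banach_mazur_stability[OF assms] centre_near_origin[OF assms] by blast

end
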